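(* Let $(r_n)_{n\ge1}$ be a sequence of positive real numbers with $\lim_{n\to\infty}r_n=0$, let $\omega=(\omega_n)_{n\ge1}$ be an i.i.d. sequence of random points uniformly distributed on $\mathbb{T}=\mathbb{R}/\mathbb{Z}$, and let $\mathcal{U}(\omega)=\{y\in\mathbb{T}:\ \exists N_0\ \forall N\ge N_0\ \exists\, 1\le n\le N,\ \|\omega_n-y\|<r_N\}$. Let $\lambda$ denote Lebesgue measure on $\mathbb{T}$. (i) Assume that $(r_n)_{n\ge1}$ is decreasing. Then either $\mathsf{P}(\lambda(\mathcal{U}(\omega))=1)=1$ or $\mathsf{P}(\lambda(\mathcal{U}(\omega))=0)=1$, depending on $(r_n)_{n\ge1}$. (ii) Suppose that the sequence $(r_n)_{n\ge1}$ is decreasing and the sequence $(nr_n)_{n\ge1}$ is increasing. Then $\lambda(\mathcal{U}(\omega))=1$ almost surely if and only if $$\sum_{n=1}^\infty r_n=\infty\qquad\text{and}\qquad \sum_{n=1}^\infty r_n e^{-2nr_n}<\infty.$$ In particular, if $c>0$ and $r_n=\frac{c\log\log n}{2n}$ for all sufficiently large $n$, then $\lambda(\mathcal{U}(\omega))=1$ almost surely if and only if $c>1$.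
   Context: $\mathbb{T}=\mathbb{R}/\mathbb{Z}$ is the one-dimensional torus with normalized Lebesgue measure $\lambda$, and $\|x\|$ denotes the distance of $x\in\mathbb{T}$ to $0$, i.e. the distance of a real representative of $x$ to the nearest integer. $\mathsf{P}$ is the underlying probability, which may be taken to be the product of the Lebesgue measures on $\mathbb{T}^{\mathbb{N}}$. Decreasing and increasing are understood in the weak sense. *)

theory Defs
  imports "HOL-Probability.Probability"
begin

text \<open>
  The torus \<open>\<real>/\<int>\<close> is represented by its fundamental domain \<open>{0..<1}\<close>; a point is thus given by
  its representative in \<open>{0..<1}\<close>. The quotient structure enters through the distance to the
  nearest integer (\<open>torus_norm\<close>), which does not depend on the choice of representative.
\<close>

definition torus :: "real measure" where
  "torus = restrict_space lborel {0..<1}"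

definition torus_norm :: "real \<Rightarrow> real" where
  "torus_norm x = infdist x \<int>"

text \<open>Measurability of the \<open>X n\<close> as maps into \<open>torus\<close> is part of \<open>indep_vars\<close>.\<close>

definition iid_uniform :: "'a measure \<Rightarrow> (nat \<Rightarrow> 'a \<Rightarrow> real) \<Rightarrow> bool" where
  "iid_uniform M X \<longleftrightarrow>
     prob_space M \<and>
     prob_space.indep_vars M (\<lambda>_. torus) X {1..} \<and>
     (\<forall>n\<ge>1. distr M torus (X n) = torus)"

text \<open>Sequences are indexed by \<open>n \<ge> 1\<close>; the values \<open>w 0\<close> and \<open>r 0\<close> play no role.\<close>

definition unif_approx :: "(nat \<Rightarrow> real) \<Rightarrow> (nat \<Rightarrow> real) \<Rightarrow> real set" where
  "unif_approx r w =
     {y \<in> {0..<1}. \<exists>N0. \<forall>N\<ge>N0. \<exists>n. 1 \<le> n \<and> n \<le> N \<and> torus_norm (w n - y) < r N}"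

lemma space_torus: "space torus = {0..<1}"
  by (simp add: torus_def space_restrict_space)

lemma prob_space_torus: "prob_space torus"
  by (rule prob_spaceI) (simp add: space_torus, simp add: torus_def emeasure_restrict_space)

lemma torus_norm_add_int: "torus_norm (x + of_int k) = torus_norm x"
proof -
  have *: "torus_norm (x + of_int k) \<le> torus_norm x" for x :: real and k :: int
    unfolding torus_norm_def
  proof (subst (2) infdist_notempty)
    show "infdist (x + of_int k) \<int> \<le> (INF a\<in>\<int>. dist x a)"
    proof (rule cINF_greatest)
      fix a :: real assume "a \<in> \<int>"
      then have "infdist (x + of_int k) \<int> \<le> dist (x + of_int k) (a + of_int k)"
        by (intro infdist_le Ints_add Ints_of_int)
      then show "infdist (x + of_int k) \<int> \<le> dist x a" by simp
    qed (use Ints_0 in blast)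
  qed (use Ints_0 in blast)
  from *[of x k] *[of "x + of_int k" "-k"] show ?thesis by simp
qed

lemma sets_unif_approx: "unif_approx r w \<in> sets torus"
proof -
  have [measurable]: "torus_norm \<in> borel_measurable borel"
    unfolding torus_norm_def by (intro borel_measurable_continuous_onI continuous_intros)
  have "{y \<in> space borel. y \<in> {0..<1} \<and>
          (\<exists>N0. \<forall>N\<in>{N0..}. \<exists>n\<in>{1..N}. torus_norm (w n - y) < r N)} \<in> sets borel"
    by measurable
  then show ?thesis
    by (simp add: torus_def sets_restrict_space_iff unif_approx_def Bex_def Ball_def
        conj_assoc subset_eq)
qed

end

theory Submission
  imports Defs "HOL-Real_Asymp.Real_Asymp"
begin

text \<open>
  Fix a point \<open>y\<close>. The distances \<open>\<parallel>\<omega>\<^sub>n - y\<parallel>\<close> are independent and uniform on \<open>[0, 1/2]\<close>,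
  whatever \<open>y\<close> is (\<open>distr_torus_distances\<close>), so the probability that \<open>y\<close> lies in
  \<open>\<U>(\<omega>)\<close> is a number \<open>hit_prob r\<close> that depends on \<open>r\<close> alone. By Fubini, \<open>hit_prob r\<close> is
  also the expectation of \<open>\<lambda>(\<U>(\<omega>))\<close>. As \<open>\<lambda>(\<U>(\<omega>))\<close> has values in \<open>[0, 1]\<close>, it is almost surely
  \<open>1\<close> iff \<open>hit_prob r = 1\<close>, and almost surely \<open>0\<close> iff \<open>hit_prob r = 0\<close>
  (\<open>AE_measure_unif_approx_iff\<close>). What remains concerns one sequence \<open>s\<close> of independent
  uniform distances and the event that \<open>min {s n | n < N} < r N\<close> for all large \<open>N\<close>.

  The dichotomy is Kolmogorov's zero-one law (\<open>hit_prob_0_1\<close>): since \<open>r N\<close> tends to \<open>0\<close>,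
  finitely many positive distances do not contribute to the event, so it agrees almost surely
  with a tail event.

  The criterion is a Borel--Cantelli argument. Call \<open>N\<close> missed if \<open>min {s n | n < N} \<ge> r N\<close>, which
  has probability \<open>(1 - 2 r N) ^ N\<close>. The series of these probabilities may diverge although
  only finitely many \<open>N\<close> are missed, because missed times come in long runs. One therefore counts
  the ends of the runs: let \<open>late r N\<close> be the event that \<open>N\<close> is missed and \<open>s N < r (N + 1)\<close>. Its
  probability \<open>2 r (N + 1) (1 - 2 r N) ^ N\<close> is of the order of \<open>r N exp (- 2 N r N)\<close>,
  except where \<open>N (r N)\<^sup>2\<close> is large and both terms are negligible.

  If the series converges, then only finitely many runs end, and as \<open>\<Sum> r n = \<infinity>\<close> forces every run
  to end, only finitely many times are missed (\<open>hit_prob_eq_1\<close>). If it diverges, then a second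
  moment estimate is needed. For \<open>m < n\<close>, the probability of \<open>late r n\<close> given \<open>late r m\<close> is at
  most \<open>2 r (n + 1) (1 - 2 r n) ^ (n - m - 1)\<close>. When \<open>m r n\<close> is bounded, this is
  comparable to the unconditional probability; the terms with \<open>m r n\<close> large have a bounded sum over
  \<open>n\<close>, as \<open>r n\<close> decreases and \<open>n r n\<close> increases (\<open>conditional_rate_bound\<close>). So the late events are
  weakly correlated, and the Chung--Erdos inequality gives infinitely many of them with positive
  probability (\<open>hit_prob_less_1\<close>).
\<close>

section \<open>The distance from a uniform point of the torus\<close>

lemma torus_norm_measurable [measurable]: "torus_norm \<in> borel_measurable borel"
  unfolding torus_norm_def by (intro borel_measurable_continuous_onI continuous_intros)

lemma torus_norm_eq:
  assumes "\<bar>d\<bar> < 1"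
  shows "torus_norm d = min \<bar>d\<bar> (1 - \<bar>d\<bar>)"
proof (rule antisym)
  have "torus_norm d \<le> dist d 0" unfolding torus_norm_def by (rule infdist_le) simp
  moreover have "torus_norm d \<le> dist d (sgn d)"
    unfolding torus_norm_def by (rule infdist_le) (simp add: sgn_if)
  moreover have "dist d (sgn d) = 1 - \<bar>d\<bar> \<or> d = 0"
    using assms by (auto simp: dist_real_def sgn_if)
  ultimately show "torus_norm d \<le> min \<bar>d\<bar> (1 - \<bar>d\<bar>)"
    by auto
next
  have "min \<bar>d\<bar> (1 - \<bar>d\<bar>) \<le> dist d a" if a: "a \<in> \<int>" for a
  proof -
    from a obtain k where k: "a = of_int k" by (auto elim: Ints_cases)
    consider "k = 0" | "k \<ge> 1" | "k \<le> -1" by linarith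
    then show ?thesis
      using assms unfolding k dist_real_def by cases (simp, linarith+)
  qed
  then show "min \<bar>d\<bar> (1 - \<bar>d\<bar>) \<le> torus_norm d"
    unfolding torus_norm_def by (subst infdist_notempty) (auto intro!: cINF_greatest)
qed

definition dist_law :: "real measure" where
  "dist_law = uniform_measure lborel {0..1/2}"

lemma prob_space_dist_law: "prob_space dist_law"
  unfolding dist_law_def by (rule prob_space_uniform_measure) simp_all

lemma sets_dist_law [measurable_cong, simp]: "sets dist_law = sets borel"
  by (simp add: dist_law_def)

lemma space_dist_law [simp]: "space dist_law = UNIV"
  by (simp add: dist_law_def)

lemma measure_dist_law_interval:
  assumes "S \<in> sets borel" "{0..1/2} \<inter> S = {a..b} \<or> {0..1/2} \<inter> S = {a..<b}" "a \<le> b"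
  shows "measure dist_law S = 2 * (b - a)"
proof -
  have "emeasure lborel {a..<b} = ennreal (b - a)" "emeasure lborel {a..b} = ennreal (b - a)"
    using assms(3) by auto
  then have "emeasure dist_law S = ennreal (b - a) / ennreal (1/2)"
    using assms unfolding dist_law_def by auto
  also have "\<dots> = ennreal (2 * (b - a))"
    using assms by (subst divide_ennreal) (auto simp: field_simps)
  finally show ?thesis using assms by (simp add: measure_def)
qed

lemma measure_dist_law_less: "0 \<le> t \<Longrightarrow> t \<le> 1/2 \<Longrightarrow> measure dist_law {..<t} = 2 * t"
  by (subst measure_dist_law_interval[of _ 0 t]) auto

lemma measure_dist_law_ge: "0 \<le> t \<Longrightarrow> t \<le> 1/2 \<Longrightarrow> measure dist_law {t..} = 1 - 2 * t"
  by (subst measure_dist_law_interval[of _ t "1/2"]) auto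

text \<open>
  The ball is an interval, except near the cut of the fundamental domain, where it splits into two;
  hence the three cases for the position of \<open>y\<close>.
\<close>
lemma measure_torus_norm_le:
  assumes y: "y \<in> {0..<1}" and t: "0 \<le> t" "t < 1/2"
  shows "measure torus {x \<in> space torus. torus_norm (x - y) \<le> t} = 2 * t"
proof -
  have eq: "torus_norm (x - y) \<le> t \<longleftrightarrow> \<bar>x - y\<bar> \<le> t \<or> 1 - t \<le> \<bar>x - y\<bar>" if "x \<in> {0..<1}" for x
  proof -
    have "\<bar>x - y\<bar> < 1" using that y by (auto simp: abs_less_iff)
    then show ?thesis by (auto simp: torus_norm_eq min_le_iff_disj)
  qed
  define S where "S = {x \<in> space torus. torus_norm (x - y) \<le> t}"
  have S: "S = {x \<in> {0..<1}. \<bar>x - y\<bar> \<le> t \<or> 1 - t \<le> \<bar>x - y\<bar>}"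
    unfolding S_def space_torus using eq by blast
  have sets: "S \<in> sets borel" unfolding S by measurable
  have em: "emeasure torus S = emeasure lborel S"
    unfolding torus_def by (rule emeasure_restrict_space) (auto simp: S)
  consider "y < t" | "t \<le> y" "y < 1 - t" | "1 - t \<le> y" by linarith
  then have "emeasure lborel S = ennreal (2 * t)"
  proof cases
    case 1
    have "S = {0..y+t} \<union> {1-t+y..<1}"
      unfolding S using 1 y t by (auto simp: abs_if split: if_splits)
    moreover have "emeasure lborel ({0..y+t} \<union> {1-t+y..<1}) = ennreal (y+t) + ennreal (t - y)"
      using 1 y t by (subst plus_emeasure[symmetric]) auto
    ultimately show ?thesis
      using 1 y by (simp flip: ennreal_plus)
  next
    case 2
    have "S = {y-t..y+t}"
      unfolding S using 2 y t by (auto simp: abs_if split: if_splits)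
    then show ?thesis using t by simp
  next
    case 3
    have "S = {0..y-(1-t)} \<union> {y-t..<1}"
      unfolding S using 3 y t by (auto simp: abs_if split: if_splits)
    moreover have "emeasure lborel ({0..y-(1-t)} \<union> {y-t..<1}) = ennreal (y-(1-t)) + ennreal (1-(y-t))"
      using 3 y t by (subst plus_emeasure[symmetric]) auto
    ultimately show ?thesis
      using 3 y by (simp flip: ennreal_plus)
  qed
  then show ?thesis
    using em t by (simp add: S_def measure_def)
qed

text \<open>
  Rotation invariance of Lebesgue measure on the torus, seen through distribution functions:
  the law of the distance to \<open>y\<close> is the same for all \<open>y\<close>.
\<close>
lemma distr_torus_norm:
  assumes y: "y \<in> {0..<1}"
  shows "distr torus borel (\<lambda>x. torus_norm (x - y)) = dist_law"
proof (rule cdf_unique)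
  interpret T: prob_space torus by (rule prob_space_torus)
  interpret D: prob_space dist_law by (rule prob_space_dist_law)
  have id[measurable]: "(\<lambda>x. x) \<in> borel_measurable torus"
    unfolding torus_def by (intro measurable_restrict_space1) simp
  have m[measurable]: "(\<lambda>x. torus_norm (x - y)) \<in> borel_measurable torus"
    by measurable
  interpret R: prob_space "distr torus borel (\<lambda>x. torus_norm (x - y))"
    by (rule T.prob_space_distr) measurable
  show "real_distribution (distr torus borel (\<lambda>x. torus_norm (x - y)))"
    by unfold_locales auto
  show "real_distribution dist_law"
    by unfold_locales auto
  have range: "0 \<le> torus_norm (x - y)" "torus_norm (x - y) \<le> 1/2" if "x \<in> {0..<1}" for x
  proof -
    have "\<bar>x - y\<bar> < 1" using that y by (auto simp: abs_less_iff)
    then show "0 \<le> torus_norm (x - y)" "torus_norm (x - y) \<le> 1/2" by (auto simp: torus_norm_eq min_def)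
  qed
  show "cdf (distr torus borel (\<lambda>x. torus_norm (x - y))) = cdf dist_law"
  proof
    fix t
    have l: "cdf (distr torus borel (\<lambda>x. torus_norm (x - y))) t
        = measure torus {x \<in> space torus. torus_norm (x - y) \<le> t}"
      unfolding cdf_def by (subst measure_distr) (auto intro!: arg_cong[where f="measure torus"])
    consider "t < 0" | "0 \<le> t" "t < 1/2" | "1/2 \<le> t" by linarith
    then show "cdf (distr torus borel (\<lambda>x. torus_norm (x - y))) t = cdf dist_law t"
    proof cases
      case 1
      have "{x \<in> space torus. torus_norm (x - y) \<le> t} = {}"
        using range 1 by (force simp: space_torus)
      moreover have "cdf dist_law t = 0" 
        unfolding cdf_def using 1 by (subst measure_dist_law_interval[of _ 0 0]) auto
      ultimately show ?thesis by (simp only: l measure_empty)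
    next
      case 2
      then have "cdf dist_law t = 2 * t"
        unfolding cdf_def by (subst measure_dist_law_interval[of _ 0 t]) auto
      with 2 y show ?thesis by (simp add: l measure_torus_norm_le)
    next
      case 3
      have "{x \<in> space torus. torus_norm (x - y) \<le> t} = space torus"
        using range 3 by (force simp: space_torus)
      moreover have "cdf dist_law t = 1" 
        unfolding cdf_def using 3 by (subst measure_dist_law_interval[of _ 0 "1/2"]) auto
      ultimately show ?thesis by (simp only: l T.prob_space)
    qed
  qed
qed

section \<open>Sequences of independent distances\<close>

definition dist_seqs :: "(nat \<Rightarrow> real) measure" where
  "dist_seqs = (\<Pi>\<^sub>M i\<in>UNIV. dist_law)"

text \<open>
  The distances are numbered from \<open>0\<close>, so that \<open>s n\<close> belongs to \<open>\<omega>\<^sub>n\<^sub>+\<^sub>1\<close> and the first \<open>N\<close>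
  points are those with \<open>n < N\<close>.
\<close>
definition always_hit :: "(nat \<Rightarrow> real) \<Rightarrow> (nat \<Rightarrow> real) \<Rightarrow> bool" where
  "always_hit r s \<longleftrightarrow> (\<exists>N0. \<forall>N\<ge>N0. \<exists>n<N. s n < r N)"

definition hit_prob :: "(nat \<Rightarrow> real) \<Rightarrow> real" where
  "hit_prob r = measure dist_seqs {s. always_hit r s}"

lemma space_dist_seqs [simp]: "space dist_seqs = UNIV"
  by (simp add: dist_seqs_def space_PiM PiE_def)

lemma prob_space_dist_seqs: "prob_space dist_seqs"
  unfolding dist_seqs_def by (intro prob_space_PiM prob_space_dist_law)

interpretation dist_seqs: prob_space dist_seqs
  by (rule prob_space_dist_seqs)

lemma measurable_dist_seqs_component [measurable]: "(\<lambda>s. s n) \<in> borel_measurable dist_seqs"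
proof -
  have "(\<lambda>s. s n) \<in> dist_seqs \<rightarrow>\<^sub>M dist_law"
    unfolding dist_seqs_def by (rule measurable_component_singleton) simp
  then show ?thesis
    by (simp cong: measurable_cong_sets)
qed

lemma measure_dist_seqs_box:
  assumes "finite J" "\<And>i. i \<in> J \<Longrightarrow> X i \<in> sets borel"
  shows "measure dist_seqs {s. \<forall>i\<in>J. s i \<in> X i} = (\<Prod>i\<in>J. measure dist_law (X i))"
proof -
  interpret D: prob_space dist_law by (rule prob_space_dist_law)
  interpret product_prob_space "\<lambda>_. dist_law" "UNIV :: nat set" ..
  have "emeasure dist_seqs {s. \<forall>i\<in>J. s i \<in> X i} = (\<Prod>i\<in>J. emeasure dist_law (X i))"
    using emeasure_PiM_Collect[of J X] assms by (simp add: dist_seqs_def space_PiM PiE_def)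
  then show ?thesis
    by (simp add: D.emeasure_eq_measure dist_seqs.emeasure_eq_measure prod_ennreal prod_nonneg)
qed

lemma pred_always_hit [measurable]: "Measurable.pred dist_seqs (always_hit r)"
proof -
  have "Measurable.pred dist_seqs (\<lambda>s. \<exists>N0. \<forall>N\<in>{N0..}. \<exists>n\<in>{..<N}. s n < r N)"
    by measurable
  then show ?thesis by (simp add: always_hit_def[abs_def] Ball_def Bex_def)
qed

lemma always_hit_cong:
  assumes "\<forall>\<^sub>F n in sequentially. r n = r' n"
  shows "always_hit r s \<longleftrightarrow> always_hit r' s"
proof -
  have "always_hit p s \<Longrightarrow> always_hit q s" if "\<forall>\<^sub>F n in sequentially. p n = q n" for p q
  proof -
    assume "always_hit p s"
    then have "\<forall>\<^sub>F N in sequentially. \<exists>n<N. s n < p N"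
      by (simp add: always_hit_def eventually_sequentially)
    with that have "\<forall>\<^sub>F N in sequentially. \<exists>n<N. s n < q N"
      by eventually_elim simp
    then show ?thesis by (simp add: always_hit_def eventually_sequentially)
  qed
  from this[OF assms] this[of r' r] assms show ?thesis by (auto simp: eq_commute)
qed

lemma hit_prob_cong: "\<forall>\<^sub>F n in sequentially. r n = r' n \<Longrightarrow> hit_prob r = hit_prob r'"
  by (simp add: hit_prob_def always_hit_cong[of r r'])

section \<open>The zero-one law\<close>

interpretation dist_law: prob_space dist_law
  by (rule prob_space_dist_law)

lemma indep_vars_dist_seqs: "dist_seqs.indep_vars (\<lambda>_. dist_law) (\<lambda>i s. s i) UNIV"
proof (subst dist_seqs.indep_vars_iff_distr_eq_PiM)
  interpret product_prob_space "\<lambda>_. dist_law" "UNIV :: nat set" ..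
  show "dist_seqs.random_variable dist_law (\<lambda>s. s i)" for i
    by (simp add: dist_seqs_def)
  show "distr dist_seqs (\<Pi>\<^sub>M i\<in>UNIV. dist_law) (\<lambda>s. \<lambda>i\<in>UNIV. s i)
      = (\<Pi>\<^sub>M i\<in>UNIV. distr dist_seqs dist_law (\<lambda>s. s i))"
    by (simp add: dist_seqs_def PiM_component restrict_UNIV)
qed simp

lemma AE_dist_seqs_pos: "AE s in dist_seqs. \<forall>n. 0 < s n"
proof -
  have "measure dist_law {..0} = 0"
    by (subst measure_dist_law_interval[of _ 0 0]) auto
  then have "AE x in dist_law. x \<notin> {..0}"
    by (intro AE_not_in) (simp add: null_sets_def dist_law.emeasure_eq_measure)
  then have "AE x in dist_law. 0 < x" by eventually_elim auto
  then have "AE s in dist_seqs. 0 < s n" for n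
    unfolding dist_seqs_def
    by (intro AE_PiM_component[where P = "\<lambda>x. 0 < x"] prob_space_dist_law) auto
  then show ?thesis by (simp add: AE_all_countable)
qed

text \<open>
  Let \<open>H k\<close> be the event with the indices \<open>n < k\<close> removed. The intersection of all \<open>H k\<close> is a
  tail event. It differs from the original event by a null set only: if all \<open>s n\<close> are positive,
  then for large \<open>N\<close> the radius \<open>r N\<close> is below all of \<open>s 0, \<dots>, s (k - 1)\<close>, and a hit comes
  from an index \<open>n \<ge> k\<close>.
\<close>
lemma hit_prob_0_1:
  assumes lim: "r \<longlonglongrightarrow> 0"
  shows "hit_prob r = 0 \<or> hit_prob r = 1"
proof -
  define A where "A i = sigma_sets UNIV {(\<lambda>s. s i) -` B \<inter> UNIV | B. B \<in> sets dist_law}"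
    for i :: nat
  define H where "H k = {s. \<exists>N0. \<forall>N\<ge>N0. \<exists>n<N. k \<le> n \<and> s n < r N}" for k :: nat
  have H_anti: "H k \<subseteq> H j" if "j \<le> k" for j k
    unfolding H_def using that by (fast intro: order_trans)
  have H_sigma: "H k \<in> sigma_sets UNIV (\<Union>(A ` {j..}))" if "j \<le> k" for j k
  proof -
    define N where "N = sigma UNIV (\<Union>(A ` {j..}))"
    have sN: "sets N = sigma_sets UNIV (\<Union>(A ` {j..}))" "space N = UNIV"
      unfolding N_def by (simp_all add: sets_measure_of space_measure_of_conv)
    \<comment> \<open>writing \<open>max k n\<close> for \<open>n\<close> makes every coordinate that occurs below measurable\<close>
    have "(\<lambda>s. s (max k n)) \<in> borel_measurable N" for n
    proof (rule measurableI)
      fix B :: "real set" assume "B \<in> sets borel"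
      then have "(\<lambda>s. s (max k n)) -` B \<in> A (max k n)"
        unfolding A_def by (intro sigma_sets.Basic) (auto simp: sets_dist_law)
      then show "(\<lambda>s. s (max k n)) -` B \<inter> space N \<in> sets N"
        unfolding sN using that by (intro sigma_sets.Basic) auto
    qed simp
    note [measurable] = this
    have "{s \<in> space N. \<exists>N0. \<forall>N\<in>{N0..}. \<exists>n\<in>{..<N}. k \<le> n \<and> s (max k n) < r N} \<in> sets N"
      by measurable
    also have "{s \<in> space N. \<exists>N0. \<forall>N\<in>{N0..}. \<exists>n\<in>{..<N}. k \<le> n \<and> s (max k n) < r N} = H k"
      unfolding H_def sN by (auto simp: Ball_def Bex_def max_def cong: conj_cong)
    finally show ?thesis by (simp only: sN)
  qed
  have "dist_seqs.prob (\<Inter>k. H k) = 0 \<or> dist_seqs.prob (\<Inter>k. H k) = 1"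
  proof (rule dist_seqs.kolmogorov_0_1_law)
    show "sigma_algebra (space dist_seqs) (A i)" for i
      unfolding A_def space_dist_seqs by (rule sigma_algebra_sigma_sets) simp
    show "dist_seqs.indep_sets A UNIV"
      using indep_vars_dist_seqs unfolding dist_seqs.indep_vars_def A_def space_dist_seqs by blast
    show "(\<Inter>k. H k) \<in> dist_seqs.tail_events A"
      unfolding dist_seqs.tail_events_def space_dist_seqs
    proof
      fix j
      interpret sigma_algebra UNIV "sigma_sets UNIV (\<Union>(A ` {j..}))"
        by (rule sigma_algebra_sigma_sets) simp
      have "(\<Inter>k. H k) = (\<Inter>k. H (k + j))"
      proof (intro equalityI INT_greatest)
        show "(\<Inter>k. H k) \<subseteq> H (k + j)" for k by blast
        show "(\<Inter>k. H (k + j)) \<subseteq> H k" for k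
          using H_anti[of k "k + j"] by auto
      qed
      also have "\<dots> \<in> sigma_sets UNIV (\<Union>(A ` {j..}))"
        using H_sigma by (intro countable_INT) auto
      finally show "(\<Inter>k. H k) \<in> sigma_sets UNIV (\<Union>(A ` {j..}))" .
    qed
  qed
  moreover have "dist_seqs.prob (\<Inter>k. H k) = hit_prob r"
    unfolding hit_prob_def
  proof (rule dist_seqs.finite_measure_eq_AE)
    show "AE s in dist_seqs. s \<in> (\<Inter>k. H k) \<longleftrightarrow> s \<in> {s. always_hit r s}"
      using AE_dist_seqs_pos
    proof eventually_elim
      case (elim s)
      show ?case
      proof
        assume "s \<in> (\<Inter>k. H k)"
        then have "s \<in> H 0" by blast
        then show "s \<in> {s. always_hit r s}" by (simp add: H_def always_hit_def)
      next
        assume "s \<in> {s. always_hit r s}"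
        then have ev: "\<forall>\<^sub>F N in sequentially. \<exists>n<N. s n < r N"
          by (simp add: always_hit_def eventually_sequentially)
        have "s \<in> H k" for k
        proof -
          have "\<forall>\<^sub>F N in sequentially. \<forall>n\<in>{..<k}. r N < s n"
            using elim by (intro eventually_ball_finite ballI order_tendstoD(2)[OF lim]) auto
          with ev have "\<forall>\<^sub>F N in sequentially. \<exists>n<N. k \<le> n \<and> s n < r N"
          proof eventually_elim
            case (elim N)
            then obtain n where n: "n < N" "s n < r N" by blast
            with elim(2) have "\<not> n < k" by (auto dest: order.asym)
            with n show ?case by (auto simp: not_less)
          qed
          then show ?thesis by (simp add: H_def eventually_sequentially)
        qed
        then show "s \<in> (\<Inter>k. H k)" by blast
      qed
    qed
    have "{s \<in> space dist_seqs. \<exists>N0. \<forall>N\<in>{N0..}. \<exists>n\<in>{..<N}. k \<le> n \<and> s n < r N} \<in> sets dist_seqs" for k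
      by measurable
    then have "H k \<in> dist_seqs.events" for k by (simp add: H_def Ball_def Bex_def)
    then show "(\<Inter>k. H k) \<in> dist_seqs.events" by auto
    have "{s \<in> space dist_seqs. always_hit r s} \<in> dist_seqs.events" by measurable
    then show "{s. always_hit r s} \<in> dist_seqs.events" by simp
  qed
  ultimately show ?thesis by simp
qed

section \<open>A second moment Borel--Cantelli lemma\<close>

text \<open>
  Cauchy--Schwarz for the counting variable \<open>Z = \<Sum> 1\<^bsub>A i\<^esub>\<close>, which vanishes off the union.
\<close>
lemma (in prob_space) Chung_Erdos:
  assumes I: "finite I" and A: "\<And>i. i \<in> I \<Longrightarrow> A i \<in> events"
  shows "(\<Sum>i\<in>I. prob (A i))\<^sup>2 \<le> prob (\<Union>i\<in>I. A i) * (\<Sum>i\<in>I. \<Sum>j\<in>I. prob (A i \<inter> A j))"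
proof -
  define S where "S = (\<Sum>i\<in>I. prob (A i))"
  define T where "T = (\<Sum>i\<in>I. \<Sum>j\<in>I. prob (A i \<inter> A j))"
  define U where "U = (\<Union>i\<in>I. A i)"
  define Z :: "'a \<Rightarrow> real" where "Z x = (\<Sum>i\<in>I. indicator (A i) x)" for x
  have [measurable]: "U \<in> events" unfolding U_def using I A by auto
  have int_ind: "integrable M (indicator B :: 'a \<Rightarrow> real)" if "B \<in> events" for B
    using that by (intro integrable_real_indicator) (auto simp: less_top[symmetric])
  have E_Z: "integrable M Z" "expectation Z = S"
    unfolding Z_def S_def using A I int_ind by (auto simp: Bochner_Integration.integral_sum)
  have Z2: "(Z x)\<^sup>2 = (\<Sum>i\<in>I. \<Sum>j\<in>I. indicator (A i \<inter> A j) x)" for x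
    unfolding Z_def power2_eq_square sum_product by (simp add: indicator_inter_arith)
  have E_Z2: "integrable M (\<lambda>x. (Z x)\<^sup>2)" "expectation (\<lambda>x. (Z x)\<^sup>2) = T"
    unfolding Z2 T_def using A I int_ind by (auto simp: Bochner_Integration.integral_sum)
  have Z0: "Z x * indicator U x = Z x" for x
    unfolding Z_def U_def by (auto simp: indicator_def sum.neutral)
  have quad: "0 \<le> T - 2 * t * S + t\<^sup>2 * prob U" for t
  proof -
    have "0 \<le> expectation (\<lambda>x. (Z x - t * indicator U x)\<^sup>2)"
      by (intro integral_nonneg_AE) auto
    also have "(\<lambda>x. (Z x - t * indicator U x)\<^sup>2) = (\<lambda>x. (Z x)\<^sup>2 - 2 * t * Z x + t\<^sup>2 * indicator U x)"
    proof
      fix x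
      have "(Z x - t * indicator U x)\<^sup>2
          = (Z x)\<^sup>2 - 2 * t * (Z x * indicator U x) + t\<^sup>2 * (indicator U x * indicator U x)"
        by (simp add: power2_eq_square algebra_simps)
      also have "indicator U x * indicator U x = (indicator U x :: real)"
        by (simp add: indicator_def)
      finally show "(Z x - t * indicator U x)\<^sup>2 = (Z x)\<^sup>2 - 2 * t * Z x + t\<^sup>2 * indicator U x"
        by (simp only: Z0)
    qed
    also have "expectation \<dots> = T - 2 * t * S + t\<^sup>2 * prob U"
      using E_Z E_Z2 int_ind[of U] by simp
    finally show ?thesis .
  qed
  have "S\<^sup>2 \<le> prob U * T"
  proof (cases "S = 0")
    case True
    then show ?thesis by (auto simp: T_def intro!: mult_nonneg_nonneg sum_nonneg)
  next
    case False
    have "prob U \<noteq> 0"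
    proof
      assume "prob U = 0"
      then have "prob (A i) = 0" if "i \<in> I" for i
        using that finite_measure_mono[of "A i" U] \<open>U \<in> events\<close> 
          measure_nonneg[of M "A i"] by (force simp: U_def)
      with False show False by (simp add: S_def)
    qed
    then have pos: "prob U > 0" by (simp add: zero_less_measure_iff)
    \<comment> \<open>the value of \<open>t\<close> that minimises the quadratic polynomial\<close>
    have "0 \<le> (T - 2 * (S / prob U) * S + (S / prob U)\<^sup>2 * prob U) * prob U"
      using quad[of "S / prob U"] pos by (intro mult_nonneg_nonneg) auto
    also have "\<dots> = T * prob U - S\<^sup>2"
      using pos by (simp add: field_simps power2_eq_square)
    finally show ?thesis by (simp add: mult.commute)
  qed
  then show ?thesis by (simp add: S_def T_def U_def)
qed

text \<open>
  Once the sum \<open>S\<close> of the probabilities over a block reaches \<open>1\<close>, the correlation bound makes the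
  double sum in the Chung--Erdos inequality at most \<open>(1 + 4 K) S\<^sup>2\<close>. So every tail
  of the sequence contains an event with probability at least \<open>1 / (1 + 4 K)\<close>.
\<close>
lemma (in prob_space) infinitely_often_pos_prob:
  fixes A :: "nat \<Rightarrow> 'a set"
  assumes A[measurable]: "\<And>n. A n \<in> events" and K: "K \<ge> 0"
    and div: "\<not> summable (\<lambda>n. prob (A n))"
    and corr: "\<And>m N. m \<ge> M0 \<Longrightarrow>
      (\<Sum>n\<in>{m<..N}. prob (A m \<inter> A n)) \<le> K * prob (A m) * (1 + (\<Sum>n\<in>{m<..N}. prob (A n)))"
  shows "prob {x \<in> space M. \<exists>\<^sub>\<infinity>n. x \<in> A n} > 0"
proof -
  define c where "c = 1 / (1 + 4 * K)"
  have c: "c > 0" using K by (simp add: c_def)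
  have fin: "c \<le> prob (\<Union>n\<in>{m..}. A n)" if m: "m \<ge> M0" for m
  proof -
    have "\<exists>N. (\<Sum>n=m..N. prob (A n)) \<ge> 1"
    proof (rule ccontr)
      assume *: "\<not> ?thesis"
      have "summable (\<lambda>n. prob (A (n + m)))"
      proof (rule summableI_nonneg_bounded)
        show "(\<Sum>i<n. prob (A (i + m))) \<le> 1" for n
        proof -
          have "(\<Sum>i<n. prob (A (i + m))) = (\<Sum>j\<in>(\<lambda>i. i + m) ` {..<n}. prob (A j))"
            by (subst sum.reindex) auto
          also have "\<dots> \<le> (\<Sum>j=m..n + m. prob (A j))"
            by (rule sum_mono2) auto
          finally show ?thesis using * by (meson le_less_trans not_le_imp_less less_imp_le)
        qed
      qed simp
      then have "summable (\<lambda>n. prob (A n))" by (subst (asm) summable_iff_shift)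
      with div show False by blast
    qed
    then obtain N where N: "(\<Sum>n=m..N. prob (A n)) \<ge> 1" by blast
    define S where "S = (\<Sum>n=m..N. prob (A n))"
    define g where "g i j = prob (A i \<inter> A j)" for i j
    have S: "S \<ge> 1" using N by (simp add: S_def)
    have half: "(\<Sum>i=m..N. \<Sum>j\<in>{i<..N}. g i j) \<le> K * S * (1 + S)"
    proof -
      have "(\<Sum>i=m..N. \<Sum>j\<in>{i<..N}. g i j) \<le> (\<Sum>i=m..N. K * prob (A i) * (1 + S))"
      proof (rule sum_mono)
        fix i assume i: "i \<in> {m..N}"
        have "(\<Sum>j\<in>{i<..N}. g i j) \<le> K * prob (A i) * (1 + (\<Sum>n\<in>{i<..N}. prob (A n)))"
          unfolding g_def by (rule corr) (use i m in auto)
        also have "\<dots> \<le> K * prob (A i) * (1 + S)"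
          unfolding S_def using K i by (intro mult_left_mono add_left_mono sum_mono2) auto
        finally show "(\<Sum>j\<in>{i<..N}. g i j) \<le> K * prob (A i) * (1 + S)" .
      qed
      also have "\<dots> = K * S * (1 + S)"
        by (simp add: S_def sum_distrib_left sum_distrib_right)
      finally show ?thesis .
    qed
    have "(\<Sum>i=m..N. \<Sum>j=m..N. g i j)
        = (\<Sum>i=m..N. g i i) + 2 * (\<Sum>i=m..N. \<Sum>j\<in>{i<..N}. g i j)"
    proof -
      have "(\<Sum>j=m..N. g i j) = (\<Sum>j=m..<i. g i j) + g i i + (\<Sum>j\<in>{i<..N}. g i j)" 
        if "i \<in> {m..N}" for i
      proof -
        have "{m..N} = {m..<i} \<union> insert i {i<..N}" using that by auto
        then show ?thesis
          by (simp only:) (subst sum.union_disjoint; auto simp: add_ac)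
      qed
      then have "(\<Sum>i=m..N. \<Sum>j=m..N. g i j)
        = (\<Sum>i=m..N. \<Sum>j=m..<i. g i j) + (\<Sum>i=m..N. g i i) + (\<Sum>i=m..N. \<Sum>j\<in>{i<..N}. g i j)"
        by (simp add: sum.distrib)
      also have "(\<Sum>i=m..N. \<Sum>j=m..<i. g i j) = (\<Sum>j=m..N. \<Sum>i\<in>{j<..N}. g i j)"
        unfolding sum.Sigma[OF finite_atLeastAtMost ballI[OF finite_atLeastLessThan]]
          sum.Sigma[OF finite_atLeastAtMost ballI[OF finite_greaterThanAtMost]]
        by (rule sum.reindex_bij_witness[of _ prod.swap prod.swap]) auto
      also have "\<dots> = (\<Sum>j=m..N. \<Sum>i\<in>{j<..N}. g j i)"
        by (simp add: g_def Int_commute)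
      finally show ?thesis by simp
    qed
    also have "(\<Sum>i=m..N. g i i) = S" by (simp add: g_def S_def)
    also have "S + 2 * (\<Sum>i=m..N. \<Sum>j\<in>{i<..N}. g i j) \<le> S + 2 * (K * S * (1 + S))"
      using half by simp
    also have "\<dots> \<le> S * S + 2 * (K * S * (S + S))"
      using S K by (intro add_mono mult_left_mono) auto
    also have "\<dots> = (1 + 4 * K) * S\<^sup>2" by (simp add: power2_eq_square algebra_simps)
    finally have T: "(\<Sum>i=m..N. \<Sum>j=m..N. g i j) \<le> (1 + 4 * K) * S\<^sup>2" .
    have "S\<^sup>2 \<le> prob (\<Union>n\<in>{m..N}. A n) * (\<Sum>i=m..N. \<Sum>j=m..N. g i j)"
      unfolding S_def g_def by (rule Chung_Erdos) auto
    also have "\<dots> \<le> prob (\<Union>n\<in>{m..N}. A n) * ((1 + 4 * K) * S\<^sup>2)"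
      using T by (intro mult_left_mono) auto
    finally have "1 * S\<^sup>2 \<le> prob (\<Union>n\<in>{m..N}. A n) * (1 + 4 * K) * S\<^sup>2" by (simp add: mult_ac)
    then have "1 \<le> prob (\<Union>n\<in>{m..N}. A n) * (1 + 4 * K)"
      using S by (subst (asm) mult_le_cancel_right) auto
    then have "c \<le> prob (\<Union>n\<in>{m..N}. A n)"
      using K by (simp add: c_def field_simps)
    also have "\<dots> \<le> prob (\<Union>n\<in>{m..}. A n)"
      by (rule finite_measure_mono) auto
    finally show ?thesis .
  qed
  have "(\<lambda>m. prob (\<Union>n\<in>{m..}. A n)) \<longlonglongrightarrow> prob (\<Inter>m. \<Union>n\<in>{m..}. A n)"
    by (rule finite_Lim_measure_decseq) (auto simp: decseq_def Bex_def intro: order_trans)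
  moreover have "\<forall>\<^sub>F m in sequentially. c \<le> prob (\<Union>n\<in>{m..}. A n)"
    using fin by (auto simp: eventually_sequentially)
  ultimately have "c \<le> prob (\<Inter>m. \<Union>n\<in>{m..}. A n)"
    by (rule tendsto_lowerbound) simp
  also have "(\<Inter>m. \<Union>n\<in>{m..}. A n) = {x \<in> space M. \<exists>\<^sub>\<infinity>n. x \<in> A n}"
    using A[THEN sets.sets_into_space] by (fastforce simp: INFM_nat_le)
  finally show ?thesis using c by linarith
qed

section \<open>Missed times and ends of runs\<close>

text \<open>
  The times \<open>N\<close> at which the target is not hit, and those among them that end a run of such
  times: if \<open>r\<close> decreases, then \<open>s \<in> late r N\<close> means that \<open>N\<close> is missed and \<open>N + 1\<close> is not.
\<close>
definition missed :: "(nat \<Rightarrow> real) \<Rightarrow> nat \<Rightarrow> (nat \<Rightarrow> real) set" where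
  "missed r N = {s. \<forall>n<N. r N \<le> s n}"

definition late :: "(nat \<Rightarrow> real) \<Rightarrow> nat \<Rightarrow> (nat \<Rightarrow> real) set" where
  "late r N = {s. s \<in> missed r N \<and> s N < r (Suc N)}"

lemma not_always_hit_iff: "\<not> always_hit r s \<longleftrightarrow> (\<exists>\<^sub>\<infinity>N. s \<in> missed r N)"
  unfolding always_hit_def missed_def INFM_nat_le mem_Collect_eq by (meson not_less)

lemma sets_missed [measurable]: "missed r N \<in> sets dist_seqs"
proof -
  have "{s \<in> space dist_seqs. \<forall>n\<in>{..<N}. r N \<le> s n} \<in> sets dist_seqs" by measurable
  then show ?thesis by (simp add: missed_def Ball_def)
qed

lemma sets_late [measurable]: "late r N \<in> sets dist_seqs"
proof -
  have "{s \<in> space dist_seqs. s \<in> missed r N \<and> s N < r (Suc N)} \<in> sets dist_seqs" by measurable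
  then show ?thesis by (simp add: late_def)
qed

lemma measure_late:
  assumes "0 \<le> r N" "r N \<le> 1/2" "0 \<le> r (Suc N)" "r (Suc N) \<le> 1/2"
  shows "measure dist_seqs (late r N) = (1 - 2 * r N) ^ N * (2 * r (Suc N))"
proof -
  define X where "X i = (if i < N then {r N..} else {..<r (Suc N)})" for i
  have "late r N = {s. \<forall>i\<in>{..N}. s i \<in> X i}"
    by (auto simp: late_def missed_def X_def le_less)
  also have "measure dist_seqs \<dots> = (\<Prod>i\<in>{..N}. measure dist_law (X i))"
    by (rule measure_dist_seqs_box) (auto simp: X_def)
  also have "{..N} = insert N {..<N}" by auto
  finally show ?thesis
    using assms by (simp add: X_def measure_dist_law_less measure_dist_law_ge)
qed

text \<open>
  The second event is weakened to its restrictions on the coordinates with index greater than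
  \<open>m\<close>. Those are independent of the first event, and the bound is the product.
\<close>
lemma measure_late_inter_le:
  assumes "m < n" and r: "\<And>k. k \<in> {m, Suc m, n, Suc n} \<Longrightarrow> 0 \<le> r k \<and> r k \<le> 1/2"
  shows "measure dist_seqs (late r m \<inter> late r n)
    \<le> measure dist_seqs (late r m) * ((1 - 2 * r n) ^ (n - Suc m) * (2 * r (Suc n)))"
proof -
  define X where "X i = (if i < m then {r m..} else if i = m then {..<r (Suc m)}
    else if i < n then {r n..} else {..<r (Suc n)})" for i
  have "late r m \<inter> late r n \<subseteq> {s. \<forall>i\<in>{..n}. s i \<in> X i}"
    using \<open>m < n\<close> by (auto simp: late_def missed_def X_def le_less)
  moreover have "{s. \<forall>i\<in>{..n}. s i \<in> X i} \<in> sets dist_seqs"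
  proof -
    have [measurable]: "X i \<in> sets borel" for i by (auto simp: X_def)
    have "{s \<in> space dist_seqs. \<forall>i\<in>{..n}. s i \<in> X i} \<in> sets dist_seqs" by measurable
    then show ?thesis by simp
  qed
  ultimately have "measure dist_seqs (late r m \<inter> late r n) 
      \<le> measure dist_seqs {s. \<forall>i\<in>{..n}. s i \<in> X i}"
    by (rule dist_seqs.finite_measure_mono)
  also have "\<dots> = (\<Prod>i\<in>{..n}. measure dist_law (X i))"
    by (rule measure_dist_seqs_box) (auto simp: X_def)
  also have "{..n} = {..<m} \<union> {m} \<union> {m<..<n} \<union> {n}" using \<open>m < n\<close> by auto
  also have "(\<Prod>i\<in>\<dots>. measure dist_law (X i)) 
      = (\<Prod>i\<in>{..<m}. measure dist_law (X i)) * measure dist_law (X m)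
        * (\<Prod>i\<in>{m<..<n}. measure dist_law (X i)) * measure dist_law (X n)"
    using \<open>m < n\<close> by (subst prod.union_disjoint; (subst prod.union_disjoint)?; 
        (subst prod.union_disjoint)?; auto)
  also have "\<dots> = (1 - 2 * r m) ^ m * (2 * r (Suc m)) * (1 - 2 * r n) ^ (n - Suc m) * (2 * r (Suc n))"
    using r \<open>m < n\<close> by (simp add: X_def measure_dist_law_less measure_dist_law_ge)
  also have "(1 - 2 * r m) ^ m * (2 * r (Suc m)) = measure dist_seqs (late r m)"
    using r by (intro measure_late[symmetric]) auto
  finally show ?thesis by (simp only: mult.assoc)
qed

section \<open>Convergent series\<close>

text \<open>
  The events \<open>s n < r (n + 1)\<close> are independent, so this is the second Borel--Cantelli lemma: a run of
  failures from \<open>m\<close> on has probability at most \<open>exp (- \<Sum> 2 r i) = 0\<close>.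
\<close>
lemma AE_hit_own_radius:
  assumes r: "\<forall>\<^sub>F n in sequentially. 0 \<le> r n \<and> r n \<le> 1/2" and div: "\<not> summable r"
  shows "AE s in dist_seqs. \<exists>\<^sub>\<infinity>n. s n < r (Suc n)"
proof -
  obtain M0 where M0: "\<And>n. n \<ge> M0 \<Longrightarrow> 0 \<le> r n \<and> r n \<le> 1/2"
    using r by (auto simp: eventually_sequentially)
  have "AE s in dist_seqs. \<exists>n\<ge>m. s n < r (Suc n)" for m
  proof -
    define m' where "m' = max m M0"
    define B where "B = {s. \<forall>n\<ge>m'. r (Suc n) \<le> s n}"
    have sets: "B \<in> sets dist_seqs"
    proof -
      have "{s \<in> space dist_seqs. \<forall>n\<in>{m'..}. r (Suc n) \<le> s n} \<in> sets dist_seqs" by measurable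
      then show ?thesis by (simp add: B_def Ball_def)
    qed
    have bound: "measure dist_seqs B \<le> exp (- (\<Sum>i<k. 2 * r (i + Suc m')))" for k
    proof -
      define J where "J = {m'..<m' + k}"
      have "measure dist_seqs B \<le> measure dist_seqs {s. \<forall>i\<in>J. s i \<in> {r (Suc i)..}}"
      proof (rule dist_seqs.finite_measure_mono)
        have "{s \<in> space dist_seqs. \<forall>i\<in>J. s i \<in> {r (Suc i)..}} \<in> sets dist_seqs" by measurable
        then show "{s. \<forall>i\<in>J. s i \<in> {r (Suc i)..}} \<in> sets dist_seqs" by simp
      qed (auto simp: B_def J_def)
      also have "\<dots> = (\<Prod>i\<in>J. measure dist_law {r (Suc i)..})"
        by (rule measure_dist_seqs_box) (auto simp: J_def)
      also have "\<dots> = (\<Prod>i\<in>J. 1 - 2 * r (Suc i))"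
        by (intro prod.cong refl measure_dist_law_ge) (use M0 in \<open>auto simp: J_def m'_def\<close>)
      also have "\<dots> \<le> (\<Prod>i\<in>J. exp (- (2 * r (Suc i))))"
      proof (rule prod_mono)
        fix i assume "i \<in> J"
        then have "r (Suc i) \<le> 1/2" using M0[of "Suc i"] by (auto simp: J_def m'_def)
        then show "0 \<le> 1 - 2 * r (Suc i) \<and> 1 - 2 * r (Suc i) \<le> exp (- (2 * r (Suc i)))"
          using exp_ge_add_one_self[of "- (2 * r (Suc i))"] by auto
      qed
      also have "\<dots> = exp (- (\<Sum>i\<in>J. 2 * r (Suc i)))"
        by (simp add: exp_sum J_def sum_negf[symmetric])
      also have "(\<Sum>i\<in>J. 2 * r (Suc i)) = (\<Sum>i<k. 2 * r (i + Suc m'))"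
        unfolding J_def by (rule sum.reindex_bij_witness[of _ "\<lambda>i. i + m'" "\<lambda>i. i - m'"]) auto
      finally show ?thesis .
    qed
    have "measure dist_seqs B = 0"
    proof (rule ccontr)
      assume "measure dist_seqs B \<noteq> 0"
      then have pos: "0 < measure dist_seqs B" by (simp add: zero_less_measure_iff)
      have "summable (\<lambda>i. 2 * r (i + Suc m'))"
      proof (rule summableI_nonneg_bounded)
        show "0 \<le> 2 * r (i + Suc m')" for i using M0[of "i + Suc m'"] by (auto simp: m'_def)
        show "(\<Sum>i<k. 2 * r (i + Suc m')) \<le> - ln (measure dist_seqs B)" for k
          using ln_mono[OF bound[of k] pos] by simp
      qed
      then have "summable r" by (simp only: summable_cmult_iff summable_iff_shift) simp
      with div show False by blast
    qed
    then have "AE s in dist_seqs. s \<notin> B"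
      using sets by (intro AE_not_in) (simp add: null_sets_def dist_seqs.emeasure_eq_measure)
    then show ?thesis by eventually_elim (force simp: B_def m'_def not_le)
  qed
  then have "AE s in dist_seqs. \<forall>m. \<exists>n\<ge>m. s n < r (Suc n)"
    by (simp add: AE_all_countable)
  then show ?thesis by (simp add: INFM_nat_le)
qed

lemma missed_Suc:
  assumes "s \<in> missed r N" "s \<notin> late r N" "r (Suc N) \<le> r N"
  shows "s \<in> missed r (Suc N)"
  using assms by (auto simp: missed_def late_def less_Suc_eq intro: order_trans)

text \<open>
  Almost surely only finitely many runs of missed times end. A missed time beyond the last end
  would start an infinite run, and then \<open>s n \<ge> r (n + 1)\<close> for all large \<open>n\<close>, against
  \<open>AE_hit_own_radius\<close>.
\<close>
lemma hit_prob_eq_1: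
  assumes anti: "antimono_on {1..} r" and lim: "r \<longlonglongrightarrow> 0" and pos: "\<forall>n\<ge>1. 0 < r n"
    and div: "\<not> summable r" and conv: "summable (\<lambda>n. r n * exp (- 2 * real n * r n))"
  shows "hit_prob r = 1"
proof -
  have half: "\<forall>\<^sub>F n in sequentially. r n < 1/2"
    using lim by (rule order_tendstoD) simp
  have r: "\<forall>\<^sub>F n in sequentially. 0 \<le> r n \<and> r n \<le> 1/2"
    using half eventually_ge_at_top[of 1] by eventually_elim (use pos in \<open>auto intro: less_imp_le\<close>)
  have dec: "r (Suc n) \<le> r n" if "n \<ge> 1" for n
    using anti that by (auto simp: monotone_on_def)
  have "summable (\<lambda>n. measure dist_seqs (late r n))"
  proof (rule summable_comparison_test_ev)
    show "summable (\<lambda>n. 2 * (r n * exp (- 2 * real n * r n)))"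
      using conv by (rule summable_mult)
    have "\<forall>\<^sub>F n in sequentially. 0 \<le> r (Suc n) \<and> r (Suc n) \<le> 1/2"
      using r by (subst eventually_sequentially_Suc)
    then show "\<forall>\<^sub>F n in sequentially. norm (measure dist_seqs (late r n)) \<le> 2 * (r n * exp (- 2 * real n * r n))"
      using r eventually_ge_at_top[of 1]
    proof eventually_elim
      case (elim n)
      have "measure dist_seqs (late r n) = (1 - 2 * r n) ^ n * (2 * r (Suc n))"
        by (rule measure_late) (use elim in auto)
      also have "\<dots> \<le> exp (- 2 * r n) ^ n * (2 * r n)"
        using elim dec[of n] exp_ge_add_one_self[of "- 2 * r n"]
        by (intro mult_mono power_mono) auto
      also have "\<dots> = 2 * (r n * exp (- 2 * real n * r n))"
        by (simp add: exp_of_nat_mult[symmetric] mult_ac)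
      finally show ?case by simp
    qed
  qed
  then have "AE s in dist_seqs. \<forall>\<^sub>F n in sequentially. s \<in> space dist_seqs - late r n"
    by (intro borel_cantelli_AE1) (auto simp: dist_seqs.emeasure_eq_measure)
  with AE_hit_own_radius[OF r div] have "AE s in dist_seqs. always_hit r s"
  proof eventually_elim
    case (elim s)
    from elim(2) obtain N1 where N1: "\<And>n. n \<ge> N1 \<Longrightarrow> s \<notin> late r n"
      by (auto simp: eventually_sequentially)
    show ?case
    proof (rule ccontr)
      assume "\<not> always_hit r s"
      then obtain N where N: "N \<ge> max N1 1" "s \<in> missed r N"
        unfolding not_always_hit_iff INFM_nat_le by blast
      have missed: "s \<in> missed r n" if "n \<ge> N" for n
        using that
      proof (induction n rule: dec_induct)
        case (step n)
        then show ?case using N N1[of n] dec[of n] by (intro missed_Suc) auto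
      qed (rule N)
      obtain n where n: "n \<ge> N" "s n < r (Suc n)" using elim(1) unfolding INFM_nat_le by blast
      from missed[of "Suc n"] n show False by (force simp: missed_def)
    qed
  qed
  moreover have "{s \<in> space dist_seqs. always_hit r s} \<in> dist_seqs.events"
    by measurable
  ultimately show ?thesis
    unfolding hit_prob_def by (subst dist_seqs.prob_eq_1) auto
qed

section \<open>Divergent series\<close>

text \<open>A geometric series whose sum is bounded uniformly in the scale \<open>a\<close>.\<close>
lemma sum_mult_exp_le:
  fixes a :: real
  assumes a: "0 < a" "a \<le> 1" and K: "finite K"
  shows "(\<Sum>k\<in>K. a * exp (- real k * a)) \<le> 2"
proof -
  have "exp (-a) < 1" using a by simp
  then have s: "(\<lambda>k. exp (-a) ^ k) sums (1 / (1 - exp (-a)))"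
    by (intro geometric_sums) simp
  have "(\<Sum>k\<in>K. exp (-a) ^ k) \<le> 1 / (1 - exp (-a))"
    using sum_le_suminf[OF sums_summable[OF s] K] sums_unique[OF s] by simp
  moreover have "exp (-a) \<le> 1 - a / 2"
  proof -
    have "exp (-a) \<le> 1 / (1 + a)"
      using exp_ge_add_one_self[of a] a by (simp add: exp_minus field_simps)
    also have "\<dots> \<le> 1 - a / 2"
    proof -
      have "a * a \<le> a" using a by (simp add: mult_le_cancel_left1)
      then show ?thesis using a by (simp add: field_simps)
    qed
    finally show ?thesis .
  qed
  moreover from this have "1 / (1 - exp (-a)) \<le> 1 / (a / 2)"
    using a by (intro divide_left_mono) auto
  ultimately have "a * (\<Sum>k\<in>K. exp (-a) ^ k) \<le> a * (1 / (a / 2))"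
    using a by (intro mult_left_mono) linarith+
  also have "\<dots> = 2" using a by simp
  finally show ?thesis
    by (simp add: sum_distrib_left exp_of_nat_mult[symmetric])
qed

lemma mult_exp_neg_antimono:
  fixes a x k :: real
  assumes "1 \<le> k * a" "0 < a" "a \<le> x"
  shows "x * exp (- k * x) \<le> a * exp (- k * a)"
proof -
  have k: "1 / a \<le> k" using assms by (simp add: field_simps)
  have "x = a * (1 + (1 / a) * (x - a))" using assms by (simp add: field_simps)
  also have "\<dots> \<le> a * (1 + k * (x - a))"
    using assms k by (intro mult_left_mono add_left_mono mult_right_mono) auto
  also have "\<dots> \<le> a * exp (k * (x - a))"
    using assms exp_ge_add_one_self[of "k * (x - a)"] by (intro mult_left_mono) auto
  finally have "x * exp (- k * x) \<le> a * exp (k * (x - a)) * exp (- k * x)"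
    by (rule mult_right_mono) simp
  also have "\<dots> = a * exp (- k * a)"
    by (simp add: mult_exp_exp algebra_simps)
  finally show ?thesis .
qed

lemma one_minus_ge_exp:
  fixes x :: real
  assumes "0 \<le> x" "x \<le> 1/2"
  shows "exp (- x - 2 * x\<^sup>2) \<le> 1 - x"
proof -
  have "exp (- x - 2 * x\<^sup>2) \<le> exp (ln (1 - x))"
    using ln_one_minus_pos_lower_bound[OF assms] by simp
  then show ?thesis using assms by simp
qed

text \<open>
  The left side bounds the probability of the late event at \<open>n\<close> given the one at
  \<open>m\<close>, with \<open>u = 2 r\<close> and \<open>v = u (n + 1)\<close>. Each summand on the right covers one regime.
  If \<open>m u n \<le> 1\<close>, then the missing factor \<open>(1 - u n) ^ (m + 1)\<close> is at least \<open>exp (- 4)\<close>.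
  Otherwise \<open>u n > 1 / m\<close>; for \<open>k \<ge> m\<close> the function \<open>x exp (- k x)\<close> decreases on
  \<open>[1 / m, \<infinity>)\<close>, so that \<open>u n\<close> may be replaced by \<open>1 / m\<close>; and for \<open>k < m\<close>, that is
  \<open>n \<le> 2 m\<close>, monotonicity of \<open>n u n\<close> gives \<open>u m / 2 \<le> u n \<le> u m\<close>. The last two summands
  are geometric in \<open>k\<close>, so their sums over \<open>n\<close> are bounded by \<open>sum_mult_exp_le\<close>.
\<close>
lemma conditional_rate_bound:
  fixes u :: "nat \<Rightarrow> real"
  assumes u: "0 < u n" "u n \<le> u m" "u m \<le> 1/2" "real m * u m \<le> real n * u n" "0 \<le> v" "v \<le> u n"
    and m: "1 \<le> m" "m < n"
  defines "k \<equiv> n - Suc m"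
  shows "(1 - u n) ^ k * v \<le> exp 4 * ((1 - u n) ^ n * v)
      + 1 / real m * exp (- real k * (1 / real m)) + u m * exp (- real k * (u m / 2))"
    (is "?q \<le> ?A + ?B + ?C")
proof -
  have un: "u n \<le> 1/2" using u by linarith
  have nonneg: "0 \<le> ?A" "0 \<le> ?B" "0 \<le> ?C" using u un by auto
  have q: "?q \<le> u n * exp (- real k * u n)"
  proof -
    have "(1 - u n) ^ k \<le> exp (- u n) ^ k"
      using un exp_ge_add_one_self[of "- u n"] by (intro power_mono) auto
    then have "(1 - u n) ^ k * v \<le> exp (- u n) ^ k * u n"
      using u by (intro mult_mono) auto
    then show ?thesis by (simp add: exp_of_nat_mult[symmetric] mult_ac)
  qed
  show ?thesis
  proof (cases "real m * u n \<le> 1")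
    case True
    have "exp (-4) \<le> exp (real (Suc m) * (- u n - 2 * (u n)\<^sup>2))"
    proof -
      have "real (Suc m) \<le> 2 * real m" using m by simp
      moreover have "(u n)\<^sup>2 \<le> u n * (1/2)"
        unfolding power2_eq_square using u un by (intro mult_left_mono) auto
      ultimately have "real (Suc m) * (u n + 2 * (u n)\<^sup>2) \<le> (2 * real m) * (2 * u n)"
        using u by (intro mult_mono) auto
      also have "\<dots> \<le> 4" using True by simp
      finally show ?thesis by (simp add: algebra_simps)
    qed
    also have "\<dots> = exp (- u n - 2 * (u n)\<^sup>2) ^ Suc m"
      by (rule exp_of_nat_mult)
    also have "\<dots> \<le> (1 - u n) ^ Suc m"
      using u un by (intro power_mono one_minus_ge_exp) auto
    finally have e: "1 \<le> exp 4 * (1 - u n) ^ Suc m"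
      by (simp add: exp_minus field_simps)
    have "1 * ?q \<le> (exp 4 * (1 - u n) ^ Suc m) * ?q"
      using e u un by (intro mult_right_mono) auto
    also have "\<dots> = exp 4 * ((1 - u n) ^ (Suc m + k) * v)"
      by (simp only: power_add mult_ac)
    also have "Suc m + k = n" using m by (simp add: k_def)
    finally have "?q \<le> ?A" by (simp only: mult_1)
    with nonneg show ?thesis by linarith
  next
    case False
    then have big: "1 / real m \<le> u n" using m by (simp add: field_simps)
    show ?thesis
    proof (cases "m \<le> k")
      case True
      have "u n * exp (- real k * u n) \<le> ?B"
        by (rule mult_exp_neg_antimono) (use True m big in \<open>auto simp: field_simps\<close>)
      with q nonneg show ?thesis by linarith
    next
      case False
      then have "n \<le> 2 * m" using m by (simp add: k_def)
      then have "real n * u n \<le> (2 * real m) * u n"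
        using u by (intro mult_right_mono) auto
      with u(4) have "real m * u m \<le> real m * (2 * u n)" by simp
      then have "u m / 2 \<le> u n" using m by simp
      then have "real k * (u m / 2) \<le> real k * u n" by (intro mult_left_mono) auto
      then have "u n * exp (- real k * u n) \<le> ?C"
        using u by (intro mult_mono) auto
      with q nonneg show ?thesis by linarith
    qed
  qed
qed

text \<open>
  The correlation bound follows from \<open>conditional_rate_bound\<close>. The probabilities \<open>P n\<close> of the late
  events have a divergent sum because, for large \<open>n\<close>, \<open>r n exp (- 2 n r n)\<close> is at most \<open>exp 2 P n\<close> where
  \<open>n (2 r n)\<^sup>2 \<le> 1\<close>, and at most the summable \<open>exp (- \<surd>n)\<close> elsewhere.
\<close>
lemma hit_prob_less_1:
  assumes anti: "antimono_on {1..} r" and lim: "r \<longlonglongrightarrow> 0" and pos: "\<forall>n\<ge>1. 0 < r n"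
    and mono: "mono_on {1..} (\<lambda>n. real n * r n)"
    and div: "\<not> summable (\<lambda>n. r n * exp (- 2 * real n * r n))"
  shows "hit_prob r < 1"
proof -
  define P where "P n = measure dist_seqs (late r n)" for n
  obtain M1 where M1: "\<And>n. n \<ge> M1 \<Longrightarrow> r n < 1/4"
    using order_tendstoD(2)[OF lim, of "1/4"] by (auto simp: eventually_sequentially)
  define M0 where "M0 = max 1 M1"
  have r: "0 < r n" "r n < 1/4" if "n \<ge> M0" for n
    using that M1[of n] pos by (auto simp: M0_def)
  have dec: "r n \<le> r m" if "1 \<le> m" "m \<le> n" for m n
    using anti that by (auto simp: monotone_on_def)
  have inc: "real m * r m \<le> real n * r n" if "1 \<le> m" "m \<le> n" for m n
    using mono that by (auto simp: monotone_on_def)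
  have P: "P n = (1 - 2 * r n) ^ n * (2 * r (Suc n))" if "n \<ge> M0" for n
    unfolding P_def by (rule measure_late) (use r[of n] r[of "Suc n"] that in auto)
  have corr: "(\<Sum>n\<in>{m<..N}. measure dist_seqs (late r m \<inter> late r n))
      \<le> (6 + exp 4) * P m * (1 + (\<Sum>n\<in>{m<..N}. P n))" if m: "m \<ge> M0" for m N
  proof -
    define F where "F n = 1 / real m * exp (- real (n - Suc m) * (1 / real m))" for n
    define G where "G n = 2 * r m * exp (- real (n - Suc m) * (2 * r m / 2))" for n
    have m1: "1 \<le> m" using m by (simp add: M0_def)
    have le: "measure dist_seqs (late r m \<inter> late r n) \<le> P m * (exp 4 * P n + F n + G n)"
      if n: "n \<in> {m<..N}" for n
    proof -
      have nM: "n \<ge> M0" using n m by auto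
      have "measure dist_seqs (late r m \<inter> late r n)
          \<le> P m * ((1 - 2 * r n) ^ (n - Suc m) * (2 * r (Suc n)))"
        unfolding P_def
      proof (rule measure_late_inter_le)
        fix k assume "k \<in> {m, Suc m, n, Suc n}"
        then have "M0 \<le> k" using m nM by auto
        from r[OF this] show "0 \<le> r k \<and> r k \<le> 1/2" by simp
      qed (use n in auto)
      also have "(1 - 2 * r n) ^ (n - Suc m) * (2 * r (Suc n)) \<le> exp 4 * P n + F n + G n"
        unfolding P[OF nM] F_def G_def
        by (rule conditional_rate_bound[where u = "\<lambda>i. 2 * r i"])
          (use r[OF nM] r[OF m] r[of "Suc n"] n m1 nM dec[of m n] dec[of n "Suc n"] inc[of m n] in auto)
      finally show ?thesis by (simp add: P_def mult_left_mono)
    qed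
    have reidx: "(\<Sum>n\<in>{m<..N}. h (n - Suc m)) = (\<Sum>k\<in>{..<N-m}. h k)" for h :: "nat \<Rightarrow> real"
      by (rule sum.reindex_bij_witness[of _ "\<lambda>k. k + Suc m" "\<lambda>n. n - Suc m"]) auto
    have F: "(\<Sum>n\<in>{m<..N}. F n) \<le> 2"
      unfolding F_def reidx[of "\<lambda>k. 1 / real m * exp (- real k * (1 / real m))"]
      by (rule sum_mult_exp_le) (use m1 in auto)
    have "(\<Sum>n\<in>{m<..N}. G n) = 2 * (\<Sum>k<N-m. r m * exp (- real k * r m))"
      unfolding G_def reidx[of "\<lambda>k. 2 * r m * exp (- real k * (2 * r m / 2))"]
      by (simp add: sum_distrib_left mult_ac)
    also have "\<dots> \<le> 2 * 2"
      using r[OF m] by (intro mult_left_mono sum_mult_exp_le) auto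
    finally have G: "(\<Sum>n\<in>{m<..N}. G n) \<le> 4" by simp
    have nn: "0 \<le> (\<Sum>n\<in>{m<..N}. P n)" by (auto simp: P_def intro: sum_nonneg)
    have "(\<Sum>n\<in>{m<..N}. measure dist_seqs (late r m \<inter> late r n))
        \<le> (\<Sum>n\<in>{m<..N}. P m * (exp 4 * P n + F n + G n))"
      by (rule sum_mono) (rule le)
    also have "\<dots> = P m * (exp 4 * (\<Sum>n\<in>{m<..N}. P n) + (\<Sum>n\<in>{m<..N}. F n) + (\<Sum>n\<in>{m<..N}. G n))"
      by (simp only: sum_distrib_left[symmetric] sum.distrib)
    also have "\<dots> \<le> P m * ((6 + exp 4) * (1 + (\<Sum>n\<in>{m<..N}. P n)))"
    proof (rule mult_left_mono)
      have "0 \<le> exp 4 + 6 * (\<Sum>n\<in>{m<..N}. P n)" using nn by (intro add_nonneg_nonneg) auto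
      then show "exp 4 * (\<Sum>n\<in>{m<..N}. P n) + (\<Sum>n\<in>{m<..N}. F n) + (\<Sum>n\<in>{m<..N}. G n)
          \<le> (6 + exp 4) * (1 + (\<Sum>n\<in>{m<..N}. P n))"
        using F G by (simp only: distrib_left distrib_right mult_1_right)
    qed (simp add: P_def)
    finally show ?thesis by (simp add: mult_ac)
  qed
  have "\<not> summable P"
  proof
    assume "summable P"
    have "summable (\<lambda>n. r n * exp (- 2 * real n * r n))"
    proof (rule summable_comparison_test_ev)
      have "summable (\<lambda>n. exp (- sqrt (real n)))"
      proof (rule summable_comparison_test_bigo)
        show "(\<lambda>n. exp (- sqrt (real n))) \<in> O(\<lambda>n. 1 / real n ^ 2)" by real_asymp
        show "summable (\<lambda>n. norm (1 / real n ^ 2))"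
          using inverse_power_summable[of 2, where 'a = real] by (simp add: divide_inverse)
      qed
      then show "summable (\<lambda>n. exp 2 * P n + exp (- sqrt (real n)))"
        using \<open>summable P\<close> by (intro summable_add summable_mult)
      show "\<forall>\<^sub>F n in sequentially. norm (r n * exp (- 2 * real n * r n))
          \<le> exp 2 * P n + exp (- sqrt (real n))"
        using eventually_ge_at_top[of M0]
      proof eventually_elim
        case (elim n)
        have n1: "1 \<le> n" using elim by (simp add: M0_def)
        note rn = r[OF elim]
        have Pn: "0 \<le> P n" by (simp add: P_def)
        define t where "t = r n * exp (- 2 * real n * r n)"
        show ?case
        proof (cases "real n * (2 * r n)\<^sup>2 \<le> 1")
          case True
          have "exp (-2) * exp (- 2 * real n * r n) \<le> exp (real n * (- (2 * r n) - 2 * (2 * r n)\<^sup>2))"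
            using True by (simp add: mult_exp_exp algebra_simps)
          also have "\<dots> = exp (- (2 * r n) - 2 * (2 * r n)\<^sup>2) ^ n"
            by (rule exp_of_nat_mult)
          also have "\<dots> \<le> (1 - 2 * r n) ^ n"
            using rn by (intro power_mono one_minus_ge_exp) auto
          finally have a: "exp (-2) * exp (- 2 * real n * r n) \<le> (1 - 2 * r n) ^ n" .
          have "real n * r n \<le> real (Suc n) * r (Suc n)" using n1 by (intro inc) auto
          also have "\<dots> \<le> (2 * real n) * r (Suc n)"
            using n1 elim r[of "Suc n"] by (intro mult_right_mono) auto
          \<comment> \<open>monotonicity of \<open>n r n\<close>: the radius at most halves from \<open>n\<close> to \<open>n + 1\<close>\<close>
          finally have "real n * r n \<le> real n * (2 * r (Suc n))" by simp
          then have b: "r n \<le> 2 * r (Suc n)" using n1 by simp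
          have "exp (-2) * exp (- 2 * real n * r n) * r n \<le> P n"
            unfolding P[OF elim] using a b rn by (intro mult_mono) auto
          then have "t \<le> exp 2 * P n"
            by (simp add: t_def exp_minus field_simps)
          also have "\<dots> \<le> exp 2 * P n + exp (- sqrt (real n))" by simp
          finally show ?thesis using rn by (simp add: t_def)
        next
          case False
          then have "1 \<le> sqrt (real n * (2 * r n)\<^sup>2)" by simp
          then have "1 \<le> sqrt (real n) * (2 * r n)" using rn by (simp add: real_sqrt_mult)
          then have "sqrt (real n) * 1 \<le> sqrt (real n) * (sqrt (real n) * (2 * r n))"
            by (intro mult_left_mono) auto
          then have "sqrt (real n) \<le> 2 * real n * r n" by (simp add: mult.assoc[symmetric])
          then have "t \<le> 1 * exp (- sqrt (real n))"
            unfolding t_def using rn by (intro mult_mono) auto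
          then show ?thesis using rn Pn by (simp add: t_def add_increasing)
        qed
      qed
    qed
    with div show False by blast
  qed
  then have "0 < measure dist_seqs {s \<in> space dist_seqs. \<exists>\<^sub>\<infinity>n. s \<in> late r n}"
    using corr unfolding P_def
    by (intro dist_seqs.infinitely_often_pos_prob[of "late r" "6 + exp 4" M0]) auto
  also have "\<dots> \<le> measure dist_seqs {s \<in> space dist_seqs. \<not> always_hit r s}"
    unfolding not_always_hit_iff
  proof (rule dist_seqs.finite_measure_mono)
    show "{s \<in> space dist_seqs. \<exists>\<^sub>\<infinity>n. s \<in> late r n} \<subseteq> {s \<in> space dist_seqs. \<exists>\<^sub>\<infinity>n. s \<in> missed r n}"
      by (auto simp: late_def elim: frequently_elim1)
    have "{s \<in> space dist_seqs. \<not> always_hit r s} \<in> dist_seqs.events" by measurable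
    then show "{s \<in> space dist_seqs. \<exists>\<^sub>\<infinity>n. s \<in> missed r n} \<in> dist_seqs.events"
      by (simp only: not_always_hit_iff)
  qed
  also have "\<dots> = 1 - hit_prob r"
  proof -
    have "{s \<in> space dist_seqs. always_hit r s} \<in> dist_seqs.events" by measurable
    from dist_seqs.prob_neg[OF this] show ?thesis by (simp add: hit_prob_def)
  qed
  finally show ?thesis by simp
qed

lemma not_summable_of_mono_mult:
  assumes pos: "0 < r 1" and mono: "mono_on {1..} (\<lambda>n. real n * r n)"
  shows "\<not> summable r"
proof
  assume "summable r"
  have "summable (\<lambda>n. r 1 * inverse (real n))"
  proof (rule summable_comparison_test_ev[OF _ \<open>summable r\<close>])
    show "\<forall>\<^sub>F n in sequentially. norm (r 1 * inverse (real n)) \<le> r n"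
      using eventually_ge_at_top[of 1]
    proof eventually_elim
      case (elim n)
      have "real 1 * r 1 \<le> real n * r n"
        by (rule monotone_onD[OF mono]) (use elim in auto)
      then show ?case using elim pos by (simp add: field_simps)
    qed
  qed
  then have "summable (\<lambda>n. inverse (real n))"
    using pos by (subst (asm) summable_cmult_iff) auto
  then show False using not_summable_harmonic[where 'a = real] by simp
qed

lemma hit_prob_eq_1_iff:
  assumes "antimono_on {1..} r" "r \<longlonglongrightarrow> 0" "\<forall>n\<ge>1. 0 < r n" "mono_on {1..} (\<lambda>n. real n * r n)"
  shows "hit_prob r = 1 \<longleftrightarrow> summable (\<lambda>n. r n * exp (- 2 * real n * r n))"
proof (cases "summable (\<lambda>n. r n * exp (- 2 * real n * r n))")
  case True
  with assms not_summable_of_mono_mult[of r] show ?thesis by (auto intro!: hit_prob_eq_1)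
next
  case False
  with hit_prob_less_1[of r] assms show ?thesis by auto
qed

section \<open>From single points to Lebesgue measure\<close>

lemma mem_unif_approx_iff:
  "y \<in> unif_approx r w \<longleftrightarrow> y \<in> {0..<1} \<and> always_hit r (\<lambda>i. torus_norm (w (Suc i) - y))"
proof -
  have "(\<exists>n. 1 \<le> n \<and> n \<le> N \<and> torus_norm (w n - y) < r N)
    \<longleftrightarrow> (\<exists>n<N. torus_norm (w (Suc n) - y) < r N)" for N
    by (metis Suc_le_eq Suc_le_D le_add1 plus_1_eq_Suc One_nat_def)
  then show ?thesis by (simp add: unif_approx_def always_hit_def)
qed

lemma measurable_torus_iff: "f \<in> N \<rightarrow>\<^sub>M torus \<longleftrightarrow> f \<in> borel_measurable N \<and> f \<in> space N \<rightarrow> {0..<1}"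
  unfolding torus_def by (auto simp: measurable_restrict_space2_iff)

lemma measurable_into_dist_seqs:
  assumes "\<And>i. f i \<in> borel_measurable N"
  shows "(\<lambda>x i. f i x) \<in> N \<rightarrow>\<^sub>M dist_seqs"
  unfolding dist_seqs_def
  by (rule measurable_PiM_single') (use assms in \<open>auto cong: measurable_cong_sets\<close>)

lemma distr_torus_distances:
  assumes iid: "iid_uniform M \<omega>" and y: "y \<in> {0..<1}"
  shows "distr M dist_seqs (\<lambda>x i. torus_norm (\<omega> (Suc i) x - y)) = dist_seqs"
proof -
  interpret prob_space M using iid by (simp add: iid_uniform_def)
  interpret P: product_prob_space "\<lambda>_. dist_law" "UNIV :: nat set" ..
  have indep: "indep_vars (\<lambda>_. torus) \<omega> {1..}" using iid by (simp add: iid_uniform_def)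
  have rv: "\<omega> (Suc i) \<in> M \<rightarrow>\<^sub>M torus" for i
    using indep by (auto simp: indep_vars_def)
  then have [measurable]: "\<omega> (Suc i) \<in> borel_measurable M" for i
    by (simp add: measurable_torus_iff)
  have id[measurable]: "(\<lambda>x. x) \<in> borel_measurable torus"
    unfolding torus_def by (intro measurable_restrict_space1) simp
  define Y where "Y n x = torus_norm (\<omega> n x - y)" for n x
  have [measurable]: "Y (Suc i) \<in> borel_measurable M" for i
    unfolding Y_def[abs_def] by measurable
  have indepY: "indep_vars (\<lambda>_. borel) Y {1..}"
    unfolding Y_def[abs_def]
    by (rule indep_vars_compose2[OF indep]) measurable
  have law: "prob (Y (Suc i) -` F \<inter> space M) = measure dist_law F" if F: "F \<in> sets borel" for i F
  proof -
    have "distr M borel (Y (Suc i)) = distr (distr M torus (\<omega> (Suc i))) borel (\<lambda>x. torus_norm (x - y))"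
      unfolding Y_def[abs_def] using rv by (subst distr_distr) (auto simp: comp_def)
    also have "distr M torus (\<omega> (Suc i)) = torus" using iid by (simp add: iid_uniform_def)
    also have "distr torus borel (\<lambda>x. torus_norm (x - y)) = dist_law"
      using y by (rule distr_torus_norm)
    finally have "distr M borel (Y (Suc i)) = dist_law" .
    with measure_distr[of "Y (Suc i)" M borel F] F show ?thesis by simp
  qed
  have meas: "(\<lambda>x i. Y (Suc i) x) \<in> M \<rightarrow>\<^sub>M dist_seqs"
    by (rule measurable_into_dist_seqs) measurable
  have "distr M dist_seqs (\<lambda>x i. Y (Suc i) x) = (\<Pi>\<^sub>M i\<in>UNIV. dist_law)"
  proof (rule P.PiM_eq)
    show "sets (distr M dist_seqs (\<lambda>x i. Y (Suc i) x)) = sets (\<Pi>\<^sub>M i\<in>UNIV. dist_law)"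
      by (simp add: dist_seqs_def)
    fix J :: "nat set" and F assume J: "finite J" and F: "\<And>j. j \<in> J \<Longrightarrow> F j \<in> sets dist_law"
    have emb: "prod_emb UNIV (\<lambda>_. dist_law) J (Pi\<^sub>E J F) = {s. \<forall>j\<in>J. s j \<in> F j}"
      by (auto simp: prod_emb_def PiE_iff)
    have "prod_emb UNIV (\<lambda>_. dist_law) J (Pi\<^sub>E J F) \<in> sets dist_seqs"
      unfolding dist_seqs_def using J F by (intro sets_PiM_I) auto
    then have "emeasure (distr M dist_seqs (\<lambda>x i. Y (Suc i) x)) {s. \<forall>j\<in>J. s j \<in> F j}
        = prob {x \<in> space M. \<forall>j\<in>J. Y (Suc j) x \<in> F j}"
      unfolding emb using meas 
      by (subst emeasure_distr) (auto simp: emeasure_eq_measure intro!: arg_cong[where f=prob])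
    also have "prob {x \<in> space M. \<forall>j\<in>J. Y (Suc j) x \<in> F j} = (\<Prod>j\<in>J. measure dist_law (F j))"
    proof (cases "J = {}")
      case False
      have "prob (\<Inter>i\<in>Suc ` J. Y i -` F (i - 1) \<inter> space M)
          = (\<Prod>i\<in>Suc ` J. prob (Y i -` F (i - 1) \<inter> space M))"
        using J False F by (intro indep_varsD[OF indepY]) (auto simp: sets_dist_law)
      also have "(\<Inter>i\<in>Suc ` J. Y i -` F (i - 1) \<inter> space M) = {x \<in> space M. \<forall>j\<in>J. Y (Suc j) x \<in> F j}"
        using False by auto
      also have "(\<Prod>i\<in>Suc ` J. prob (Y i -` F (i - 1) \<inter> space M)) = (\<Prod>j\<in>J. measure dist_law (F j))"
        using F by (subst prod.reindex) (auto intro!: prod.cong law)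
      finally show ?thesis .
    qed (simp add: prob_space)
    finally show "emeasure (distr M dist_seqs (\<lambda>x i. Y (Suc i) x))
        (prod_emb UNIV (\<lambda>_. dist_law) J (Pi\<^sub>E J F)) = (\<Prod>j\<in>J. emeasure dist_law (F j))"
      unfolding emb by (simp add: dist_law.emeasure_eq_measure prod_ennreal)
  qed
  then show ?thesis by (simp add: dist_seqs_def Y_def)
qed

lemma prob_mem_unif_approx:
  assumes iid: "iid_uniform M \<omega>" and y: "y \<in> {0..<1}"
  shows "measure M {x \<in> space M. y \<in> unif_approx r (\<lambda>n. \<omega> n x)} = hit_prob r"
proof -
  define Y where "Y x i = torus_norm (\<omega> (Suc i) x - y)" for x and i :: nat
  have "\<omega> (Suc i) \<in> M \<rightarrow>\<^sub>M torus" for i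
    using iid unfolding iid_uniform_def by (auto simp: prob_space.indep_vars_def)
  then have [measurable]: "\<omega> (Suc i) \<in> borel_measurable M" for i
    by (simp add: measurable_torus_iff)
  have meas: "Y \<in> M \<rightarrow>\<^sub>M dist_seqs"
    unfolding Y_def[abs_def] by (rule measurable_into_dist_seqs) measurable
  have ev: "{s. always_hit r s} \<in> sets dist_seqs"
    using pred_always_hit[of r] by (simp add: pred_def)
  have "hit_prob r = measure (distr M dist_seqs Y) {s. always_hit r s}"
    unfolding Y_def[abs_def] distr_torus_distances[OF iid y] hit_prob_def ..
  also have "\<dots> = measure M (Y -` {s. always_hit r s} \<inter> space M)"
    using meas ev by (rule measure_distr)
  also have "Y -` {s. always_hit r s} \<inter> space M = {x \<in> space M. y \<in> unif_approx r (\<lambda>n. \<omega> n x)}"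
    using y by (auto simp: mem_unif_approx_iff Y_def[abs_def])
  finally show ?thesis ..
qed

text \<open>Fubini, applied to the set of all pairs \<open>(x, y)\<close> with \<open>y \<in> \<U>(\<omega> x)\<close>.\<close>
lemma expectation_measure_unif_approx:
  assumes iid: "iid_uniform M \<omega>"
  shows "(\<lambda>x. measure torus (unif_approx r (\<lambda>n. \<omega> n x))) \<in> borel_measurable M"
    and "(\<integral>x. measure torus (unif_approx r (\<lambda>n. \<omega> n x)) \<partial>M) = hit_prob r"
proof -
  interpret prob_space M using iid by (simp add: iid_uniform_def)
  interpret T: prob_space torus by (rule prob_space_torus)
  interpret pair_sigma_finite M torus ..
  define U where "U x = unif_approx r (\<lambda>n. \<omega> n x)" for x
  define B where "B = {p \<in> space (M \<Otimes>\<^sub>M torus). snd p \<in> U (fst p)}"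
  have U_sub: "U x \<subseteq> {0..<1}" for x by (auto simp: U_def unif_approx_def)
  have "\<omega> (Suc i) \<in> M \<rightarrow>\<^sub>M torus" for i
    using iid unfolding iid_uniform_def by (auto simp: prob_space.indep_vars_def)
  then have [measurable]: "\<omega> (Suc i) \<in> borel_measurable M" for i
    by (simp add: measurable_torus_iff)
  have [measurable]: "(\<lambda>x. x) \<in> borel_measurable torus"
    unfolding torus_def by (intro measurable_restrict_space1) simp
  have B: "B \<in> sets (M \<Otimes>\<^sub>M torus)"
  proof -
    have "(\<lambda>p i. torus_norm (\<omega> (Suc i) (fst p) - snd p)) \<in> M \<Otimes>\<^sub>M torus \<rightarrow>\<^sub>M dist_seqs"
      by (rule measurable_into_dist_seqs) measurable
    from measurable_compose[OF this pred_always_hit[of r]]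
    have "{p \<in> space (M \<Otimes>\<^sub>M torus). always_hit r (\<lambda>i. torus_norm (\<omega> (Suc i) (fst p) - snd p))}
        \<in> sets (M \<Otimes>\<^sub>M torus)"
      by (simp add: pred_def)
    also have "{p \<in> space (M \<Otimes>\<^sub>M torus). always_hit r (\<lambda>i. torus_norm (\<omega> (Suc i) (fst p) - snd p))} = B"
      by (auto simp: B_def U_def mem_unif_approx_iff space_pair_measure space_torus)
    finally show ?thesis .
  qed
  have section_x: "Pair x -` B = U x" if "x \<in> space M" for x
    using that U_sub[of x] by (auto simp: B_def space_pair_measure space_torus)
  have section_y: "(\<lambda>x. (x, y)) -` B = {x \<in> space M. y \<in> U x}" if "y \<in> space torus" for y
    using that by (auto simp: B_def space_pair_measure)
  have "(\<lambda>x. emeasure torus (Pair x -` B)) \<in> borel_measurable M"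
    using B by (rule T.measurable_emeasure_Pair)
  then have "(\<lambda>x. emeasure torus (U x)) \<in> borel_measurable M"
    using section_x by (simp cong: measurable_cong)
  then show meas: "(\<lambda>x. measure torus (unif_approx r (\<lambda>n. \<omega> n x))) \<in> borel_measurable M"
    unfolding measure_def U_def by measurable
  have "(\<integral>\<^sup>+x. ennreal (measure torus (U x)) \<partial>M) = (\<integral>\<^sup>+x. emeasure torus (Pair x -` B) \<partial>M)"
    by (intro nn_integral_cong) (simp add: section_x T.emeasure_eq_measure)
  also have "\<dots> = emeasure (M \<Otimes>\<^sub>M torus) B"
    using B by (rule T.emeasure_pair_measure_alt[symmetric])
  also have "\<dots> = (\<integral>\<^sup>+y. emeasure M ((\<lambda>x. (x, y)) -` B) \<partial>torus)"
    using B by (rule emeasure_pair_measure_alt2)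
  also have "\<dots> = (\<integral>\<^sup>+y. ennreal (hit_prob r) \<partial>torus)"
    by (intro nn_integral_cong)
      (simp add: section_y emeasure_eq_measure U_def prob_mem_unif_approx[OF iid] space_torus)
  also have "\<dots> = ennreal (hit_prob r)" by (simp add: T.emeasure_space_1)
  finally have nn: "(\<integral>\<^sup>+x. ennreal (measure torus (U x)) \<partial>M) = ennreal (hit_prob r)" .
  have "(\<integral>x. measure torus (U x) \<partial>M) = enn2real (\<integral>\<^sup>+x. ennreal (measure torus (U x)) \<partial>M)"
    by (rule integral_eq_nn_integral) (use meas in \<open>auto simp: U_def\<close>)
  also have "\<dots> = hit_prob r"
    unfolding nn by (simp add: hit_prob_def)
  finally show "(\<integral>x. measure torus (unif_approx r (\<lambda>n. \<omega> n x)) \<partial>M) = hit_prob r"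
    by (simp only: U_def)
qed

lemma AE_measure_unif_approx_iff:
  assumes iid: "iid_uniform M \<omega>"
  shows "(AE x in M. measure torus (unif_approx r (\<lambda>n. \<omega> n x)) = 1) \<longleftrightarrow> hit_prob r = 1"
    and "(AE x in M. measure torus (unif_approx r (\<lambda>n. \<omega> n x)) = 0) \<longleftrightarrow> hit_prob r = 0"
proof -
  interpret prob_space M using iid by (simp add: iid_uniform_def)
  interpret T: prob_space torus by (rule prob_space_torus)
  define f where "f x = measure torus (unif_approx r (\<lambda>n. \<omega> n x))" for x
  have [measurable]: "f \<in> borel_measurable M" and E: "expectation f = hit_prob r"
    unfolding f_def[abs_def] by (rule expectation_measure_unif_approx[OF iid])+
  have int: "integrable M f"
    by (rule integrable_const_bound[of _ 1]) (auto simp: f_def)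
  show "(AE x in M. measure torus (unif_approx r (\<lambda>n. \<omega> n x)) = 0) \<longleftrightarrow> hit_prob r = 0"
    using integral_nonneg_eq_0_iff_AE[OF int] E by (simp add: f_def)
  have "expectation (\<lambda>x. 1 - f x) = 1 - hit_prob r"
    using int E by (simp add: prob_space)
  moreover have "expectation (\<lambda>x. 1 - f x) = 0 \<longleftrightarrow> (AE x in M. 1 - f x = 0)"
  proof (rule integral_nonneg_eq_0_iff_AE)
    show "integrable M (\<lambda>x. 1 - f x)" using int by simp
    show "AE x in M. 0 \<le> 1 - f x" by (simp add: f_def)
  qed
  moreover have "1 - f x = 0 \<longleftrightarrow> f x = 1" for x by auto
  ultimately show "(AE x in M. measure torus (unif_approx r (\<lambda>n. \<omega> n x)) = 1) \<longleftrightarrow> hit_prob r = 1"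
    by (simp add: f_def)
qed

section \<open>The double logarithm\<close>

text \<open>
  Comparison with telescoping sums: with the differences of \<open>(ln n) powr (- d)\<close>, where
  \<open>c = 1 + 2 d\<close>, so that one \<open>d\<close> absorbs the factor \<open>ln (ln n)\<close>, if \<open>c > 1\<close>; and with the
  differences of \<open>ln (ln n)\<close> if \<open>c \<le> 1\<close>.
\<close>
lemma summable_loglog_iff:
  fixes c :: real
  assumes c: "c > 0"
  shows "summable (\<lambda>n. ln (ln (real n)) / real n * ln (real n) powr (- c)) \<longleftrightarrow> c > 1"
proof
  assume "c > 1"
  define d where "d = (c - 1) / 2"
  have d: "d > 0" and cd: "c = 1 + 2 * d" using \<open>c > 1\<close> by (simp_all add: d_def field_simps)
  show "summable (\<lambda>n. ln (ln (real n)) / real n * ln (real n) powr (- c))"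
  proof (rule summable_comparison_test_bigo)
    have "(\<lambda>n. ln (real n) powr (- d)) \<longlonglongrightarrow> 0"
      using d by real_asymp
    from telescope_summable'[OF this]
    have tele: "summable (\<lambda>n. ln (real n) powr (- d) - ln (real (Suc n)) powr (- d))" .
    have "\<forall>\<^sub>F n in sequentially. norm (ln (real n) powr (- d) - ln (real (Suc n)) powr (- d))
        = ln (real n) powr (- d) - ln (real (Suc n)) powr (- d)"
      using eventually_ge_at_top[of 2]
    proof eventually_elim
      case (elim n)
      have "ln (real (Suc n)) powr (- d) \<le> ln (real n) powr (- d)"
        using d elim by (intro powr_mono2') auto
      then show ?case by simp
    qed
    from summable_cong[OF this] tele
    show "summable (\<lambda>n. norm (ln (real n) powr (- d) - ln (real (Suc n)) powr (- d)))" by simp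
    show "(\<lambda>n. ln (ln (real n)) / real n * ln (real n) powr (- c))
        \<in> O(\<lambda>n. ln (real n) powr (- d) - ln (real (Suc n)) powr (- d))"
      unfolding cd using d by real_asymp
  qed
next
  assume *: "summable (\<lambda>n. ln (ln (real n)) / real n * ln (real n) powr (- c))"
  show "c > 1"
  proof (rule ccontr)
    assume "\<not> c > 1"
    have "summable (\<lambda>n. ln (ln (real (Suc n))) - ln (ln (real n)))"
    proof (rule summable_comparison_test_bigo)
      have "\<forall>\<^sub>F n in sequentially. norm (ln (ln (real n)) / real n * ln (real n) powr (- c))
          = ln (ln (real n)) / real n * ln (real n) powr (- c)"
      proof -
        have "\<forall>\<^sub>F n in sequentially. 0 < ln (ln (real n))" by real_asymp
        then show ?thesis by eventually_elim simp
      qed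
      from summable_cong[OF this] * 
      show "summable (\<lambda>n. norm (ln (ln (real n)) / real n * ln (real n) powr (- c)))" by simp
      have "(\<lambda>n. ln (ln (real (Suc n))) - ln (ln (real n)))
          \<in> O(\<lambda>n. ln (ln (real n)) / real n * ln (real n) powr (- 1))"
        by real_asymp
      also have "(\<lambda>n. ln (ln (real n)) / real n * ln (real n) powr (- 1))
          \<in> O(\<lambda>n. ln (ln (real n)) / real n * ln (real n) powr (- c))"
      proof (rule landau_o.big.mult_left[OF landau_o.bigI[of 1]])
        have "\<forall>\<^sub>F n in sequentially. 1 \<le> ln (real n)" by real_asymp
        then show "\<forall>\<^sub>F n in sequentially. norm (ln (real n) powr - 1) \<le> 1 * norm (ln (real n) powr - c)"
        proof eventually_elim
          case (elim n)
          have "ln (real n) powr - 1 \<le> ln (real n) powr - c"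
            using elim \<open>\<not> c > 1\<close> by (intro powr_mono) auto
          then show ?case by simp
        qed
      qed simp
      finally show "(\<lambda>n. ln (ln (real (Suc n))) - ln (ln (real n)))
          \<in> O(\<lambda>n. ln (ln (real n)) / real n * ln (real n) powr (- c))" .
    qed
    then have "convergent (\<lambda>n. \<Sum>i<n. ln (ln (real (Suc i))) - ln (ln (real i)))"
      by (simp add: summable_iff_convergent)
    then obtain L where "(\<lambda>n. ln (ln (real n)) - ln (ln (real 0))) \<longlonglongrightarrow> L"
      using sum_lessThan_telescope[of "\<lambda>n. ln (ln (real n))"] by (auto simp only: convergent_def)
    moreover have "filterlim (\<lambda>n. ln (ln (real n)) - ln (ln (real 0))) at_top sequentially"
      by real_asymp
    ultimately show False
      using not_tendsto_and_filterlim_at_infinity[OF sequentially_bot] 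
        filterlim_at_top_imp_at_infinity by blast
  qed
qed

lemma ln_ln_over_self_antimono:
  fixes x y :: real
  assumes "exp (exp 1) \<le> x" "x \<le> y"
  shows "ln (ln y) / y \<le> ln (ln x) / x"
proof (rule DERIV_nonpos_imp_nonincreasing[OF \<open>x \<le> y\<close>])
  fix z assume z: "x \<le> z" "z \<le> y"
  have z0: "z > 0" using z assms exp_gt_zero[of "exp 1"] by linarith
  have l1: "exp 1 \<le> ln z" using z assms z0 by (simp add: ln_ge_iff)
  have l0: "ln z > 0" using l1 exp_gt_zero[of 1] by linarith
  have l2: "1 \<le> ln (ln z)" using l1 l0 by (simp add: ln_ge_iff)
  have "1 / ln z \<le> 1"
    using l1 exp_ge_add_one_self[of "1::real"] by (simp add: field_simps)
  then have "(1 / ln z - ln (ln z)) / z\<^sup>2 \<le> 0" using l2 by (intro divide_nonpos_nonneg) auto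
  moreover have "((\<lambda>z. ln (ln z) / z) has_real_derivative (1 / ln z - ln (ln z)) / z\<^sup>2) (at z)"
    using z0 l0 by (auto intro!: derivative_eq_intros simp: field_simps power2_eq_square)
  ultimately show "\<exists>d. ((\<lambda>z. ln (ln z) / z) has_real_derivative d) (at z) \<and> d \<le> 0" by blast
qed

text \<open>
  Only the values of \<open>r\<close> for large \<open>n\<close> matter, while the criterion asks for monotonicity from \<open>1\<close>
  on. So \<open>r\<close> is replaced by \<open>q\<close>, in which the double logarithm is frozen below \<open>K\<close>; the
  threshold \<open>K \<ge> exp (exp 1)\<close> is where \<open>ln (ln x) / x\<close> is known to decrease.
\<close>
lemma hit_prob_loglog_iff:
  fixes r :: "nat \<Rightarrow> real" and c :: real
  assumes c: "c > 0" and r: "\<forall>\<^sub>F n in sequentially. r n = c * ln (ln (real n)) / (2 * real n)"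
  shows "hit_prob r = 1 \<longleftrightarrow> c > 1"
proof -
  define K where "K = nat \<lceil>exp (exp 1 :: real)\<rceil>"
  define L where "L n = ln (ln (real (max n K)))" for n
  define q where "q n = c * L n / (2 * real n)" for n
  have K: "exp (exp 1) \<le> real K" unfolding K_def by linarith
  have Lpos: "1 \<le> L n" for n
  proof -
    have x: "exp (exp 1) \<le> real (max n K)" using K by simp
    then have "exp 1 \<le> ln (real (max n K))"
      by (metis exp_gt_zero less_le_trans ln_ge_iff)
    then show ?thesis unfolding L_def by (metis exp_gt_zero less_le_trans ln_ge_iff)
  qed
  have Lmono: "L m \<le> L n" if "m \<le> n" for m n
  proof -
    have "1 < real K"
      using K exp_ge_add_one_self[of "exp 1 :: real"] exp_gt_zero[of "1::real"] by linarith
    then have "1 < real (max m K)" by simp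
    moreover have "real (max m K) \<le> real (max n K)" using that by simp
    ultimately show ?thesis unfolding L_def by (subst ln_le_cancel_iff; simp)
  qed
  have Lquot: "L n / real n \<le> L m / real m" if "1 \<le> m" "m \<le> n" for m n
  proof -
    have L: "L n = ln (ln (real n))" if "K \<le> n" for n using that by (simp add: L_def max_absorb1)
    have Lc: "L n = L K" if "n \<le> K" for n using that by (simp add: L_def max_absorb2)
    have below: "L n' / real n' \<le> L m / real m" if "m \<le> n'" "n' \<le> K" for n'
    proof -
      have "L K / real n' \<le> L K / real m"
        using that \<open>1 \<le> m\<close> Lpos[of K] by (intro divide_left_mono mult_pos_pos) auto
      then show ?thesis using that Lc[of n'] Lc[of m] by simp
    qed
    have above: "L n / real n \<le> L m' / real m'" if "K \<le> m'" "m' \<le> n" for m'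
    proof -
      have "exp (exp 1) \<le> real m'" using K that by linarith
      then show ?thesis using that L[of n] L[of m'] ln_ln_over_self_antimono[of "real m'" "real n"] by simp
    qed
    show ?thesis
      using below[of n] below[of K] above[of K] above[of m] that by linarith
  qed
  have q_half: "real n * q n = c / 2 * L n" if "n \<ge> 1" for n
    using that by (simp add: q_def field_simps)
  have q_quot: "q n = c / 2 * (L n / real n)" for n by (simp add: q_def)
  have eq: "\<forall>\<^sub>F n in sequentially. r n = q n"
    using r eventually_ge_at_top[of K] by eventually_elim (simp add: q_def L_def max_absorb1)
  have anti: "antimono_on {1..} q"
  proof (rule monotone_onI)
    fix m n :: nat assume "m \<in> {1..}" "m \<le> n"
    then show "q n \<le> q m"
      unfolding q_quot using c Lquot[of m n] by (intro mult_left_mono) auto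
  qed
  have mono: "mono_on {1..} (\<lambda>n. real n * q n)"
    using c Lmono by (auto simp: monotone_on_def q_half intro!: mult_left_mono)
  have pos: "\<forall>n\<ge>1. 0 < q n"
  proof (intro allI impI)
    fix n :: nat assume "1 \<le> n"
    moreover have "0 < L n" using Lpos[of n] by linarith
    ultimately show "0 < q n" using c by (simp add: q_def)
  qed
  have lim: "q \<longlonglongrightarrow> 0"
  proof (rule Lim_transform_eventually)
    show "(\<lambda>n. c * ln (ln (real n)) / (2 * real n)) \<longlonglongrightarrow> 0" by real_asymp
    show "\<forall>\<^sub>F n in sequentially. c * ln (ln (real n)) / (2 * real n) = q n"
      using r eq by eventually_elim simp
  qed
  have "\<forall>\<^sub>F n in sequentially. q n * exp (- 2 * real n * q n)
      = c / 2 * (ln (ln (real n)) / real n * ln (real n) powr (- c))"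
    using eventually_ge_at_top[of K]
  proof eventually_elim
    case (elim n)
    have n: "exp (exp 1) \<le> real n" using K elim by linarith
    then have n0: "0 < real n" using exp_gt_zero[of "exp 1 :: real"] by linarith
    have "exp 1 \<le> ln (real n)" using n n0 by (simp add: ln_ge_iff)
    then have "0 < ln (real n)" using exp_gt_zero[of "1 :: real"] by linarith
    moreover have "L n = ln (ln (real n))" using elim by (simp add: L_def max_absorb1)
    moreover have "- 2 * real n * q n = - c * L n" using n0 by (simp add: q_def)
    ultimately show ?case by (simp add: q_quot powr_def)
  qed
  then have "summable (\<lambda>n. q n * exp (- 2 * real n * q n))
      \<longleftrightarrow> summable (\<lambda>n. c / 2 * (ln (ln (real n)) / real n * ln (real n) powr (- c)))"
    by (rule summable_cong)
  also have "\<dots> \<longleftrightarrow> c > 1"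
    using c summable_loglog_iff[OF c] by (subst summable_cmult_iff) auto
  finally show ?thesis
    using hit_prob_cong[OF eq] hit_prob_eq_1_iff[OF anti lim pos mono] by simp
qed

section \<open>The dichotomy and the criterion\<close>

lemma suminf_ennreal_Suc_less_top_iff:
  assumes "\<And>n. n \<ge> 1 \<Longrightarrow> 0 \<le> g n"
  shows "(\<Sum>n. ennreal (g (Suc n))) < \<infinity> \<longleftrightarrow> summable g"
proof -
  have "(\<Sum>n. ennreal (g (Suc n))) \<noteq> top \<longleftrightarrow> summable (\<lambda>n. g (Suc n))"
  proof
    show "summable (\<lambda>n. g (Suc n))" if "(\<Sum>n. ennreal (g (Suc n))) \<noteq> top"
      by (rule summable_suminf_not_top[OF _ that]) (use assms in simp)
    show "(\<Sum>n. ennreal (g (Suc n))) \<noteq> top" if "summable (\<lambda>n. g (Suc n))"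
      by (rule ennreal_suminf_neq_top[OF that]) (use assms in simp)
  qed
  then show ?thesis by (simp only: summable_Suc_iff less_top infinity_ennreal_def)
qed

theorem theorem2:
  fixes r :: "nat \<Rightarrow> real"
  assumes r_pos: "\<forall>n\<ge>1. r n > 0"
    and r_lim: "r \<longlonglongrightarrow> 0"
  shows
    "(antimono_on {1..} r \<longrightarrow>
        (\<forall>(M :: 'a measure) \<omega>. iid_uniform M \<omega> \<longrightarrow>
           measure M {x \<in> space M. measure torus (unif_approx r (\<lambda>n. \<omega> n x)) = 1} = 1) \<or>
        (\<forall>(M :: 'a measure) \<omega>. iid_uniform M \<omega> \<longrightarrow>
           measure M {x \<in> space M. measure torus (unif_approx r (\<lambda>n. \<omega> n x)) = 0} = 1)) \<and>
     (antimono_on {1..} r \<and> mono_on {1..} (\<lambda>n. real n * r n) \<longrightarrow>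
        (\<forall>(M :: 'a measure) \<omega>. iid_uniform M \<omega> \<longrightarrow>
           ((AE x in M. measure torus (unif_approx r (\<lambda>n. \<omega> n x)) = 1) \<longleftrightarrow>
            (\<Sum>n. ennreal (r (Suc n))) = \<infinity> \<and>
            (\<Sum>n. ennreal (r (Suc n) * exp (- 2 * real (Suc n) * r (Suc n)))) < \<infinity>))) \<and>
     (\<forall>c>0. (\<forall>\<^sub>F n in sequentially. r n = c * ln (ln (real n)) / (2 * real n)) \<longrightarrow>
        (\<forall>(M :: 'a measure) \<omega>. iid_uniform M \<omega> \<longrightarrow>
           ((AE x in M. measure torus (unif_approx r (\<lambda>n. \<omega> n x)) = 1) \<longleftrightarrow> c > 1)))"
proof (intro conjI impI allI; (elim conjE)?)
  have prob_1: "measure M {x \<in> space M. measure torus (unif_approx r (\<lambda>n. \<omega> n x)) = a} = 1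
      \<longleftrightarrow> (AE x in M. measure torus (unif_approx r (\<lambda>n. \<omega> n x)) = a)"
    if iid: "iid_uniform M \<omega>" for M :: "'a measure" and \<omega> a
  proof -
    interpret prob_space M using iid by (simp add: iid_uniform_def)
    note [measurable] = expectation_measure_unif_approx(1)[OF iid]
    show ?thesis by (rule prob_Collect_eq_1) measurable
  qed
  show "(\<forall>(M :: 'a measure) \<omega>. iid_uniform M \<omega> \<longrightarrow>
           measure M {x \<in> space M. measure torus (unif_approx r (\<lambda>n. \<omega> n x)) = 1} = 1) \<or>
        (\<forall>(M :: 'a measure) \<omega>. iid_uniform M \<omega> \<longrightarrow>
           measure M {x \<in> space M. measure torus (unif_approx r (\<lambda>n. \<omega> n x)) = 0} = 1)"
    using hit_prob_0_1[OF r_lim] by (auto simp: prob_1 AE_measure_unif_approx_iff)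
next
  fix M :: "'a measure" and \<omega>
  assume r: "antimono_on {1..} r" "mono_on {1..} (\<lambda>n. real n * r n)" and iid: "iid_uniform M \<omega>"
  have "(\<Sum>n. ennreal (r (Suc n))) = \<infinity>"
  proof (rule ccontr)
    assume "(\<Sum>n. ennreal (r (Suc n))) \<noteq> \<infinity>"
    then have "(\<Sum>n. ennreal (r (Suc n))) < \<infinity>" by (simp only: less_top infinity_ennreal_def)
    then have "summable r"
      using r_pos by (subst (asm) suminf_ennreal_Suc_less_top_iff) (auto simp: less_imp_le)
    with not_summable_of_mono_mult[of r] r_pos r(2) show False by simp
  qed
  moreover have "(\<Sum>n. ennreal (r (Suc n) * exp (- 2 * real (Suc n) * r (Suc n)))) < \<infinity>
      \<longleftrightarrow> summable (\<lambda>n. r n * exp (- 2 * real n * r n))"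
    using r_pos by (intro suminf_ennreal_Suc_less_top_iff) (auto simp: less_imp_le)
  ultimately show "(AE x in M. measure torus (unif_approx r (\<lambda>n. \<omega> n x)) = 1) \<longleftrightarrow>
      (\<Sum>n. ennreal (r (Suc n))) = \<infinity> \<and>
      (\<Sum>n. ennreal (r (Suc n) * exp (- 2 * real (Suc n) * r (Suc n)))) < \<infinity>"
    using AE_measure_unif_approx_iff(1)[OF iid] hit_prob_eq_1_iff[OF r(1) r_lim r_pos r(2)] by simp
next
  fix c :: real and M :: "'a measure" and \<omega>
  assume "c > 0" "\<forall>\<^sub>F n in sequentially. r n = c * ln (ln (real n)) / (2 * real n)" "iid_uniform M \<omega>"
  then show "(AE x in M. measure torus (unif_approx r (\<lambda>n. \<omega> n x)) = 1) \<longleftrightarrow> c > 1"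
    by (simp add: AE_measure_unif_approx_iff(1) hit_prob_loglog_iff)
qed

end
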